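(* Let $m,n\ge 2$ and let $S=S(m,n;\underline{t})$ be the special Lie superalgebra over a field $\mathbb{F}$ of characteristic $p>2$. Let $\phi$ be a skew-symmetric super-biderivation of $S$. For any $k_0\in Y_0$, $k_1,i_1,j_1\in Y_1$ with $i_1\neq k_1$ and $j_1\neq i_1$, there is an element $\mu_{k_0k_1i_1}\in\mathbb{F}$, depending (for given $\phi$) only on $k_0$, $k_1$ and $i_1$, such that $$\phi(D_{k_0k_1}(x_{k_0}x_{k_1}),D_{i_1j_1}(x_{j_1}x_{k_0}))=\mu_{k_0k_1i_1}[D_{k_0k_1}(x_{k_0}x_{k_1}),D_{i_1j_1}(x_{j_1}x_{k_0})].$$
   Context: Conventions. $\mathbb{F}$ is a field of characteristic $p>2$; $\mathbb{Z}_2=\{\bar 0,\bar 1\}$; $\mathrm{d}(x)$ denotes the $\mathbb{Z}_2$-degree (parity) of $x$, and whenever $\mathrm{d}(x)$ appears, $x$ is assumed $\mathbb{Z}_2$-homogeneous. A Lie superalgebra is a superspace $L=L_{\bar 0}\oplus L_{\bar 1}$ with an even bilinear bracket satisfying $[x,y]=-(-1)^{\mathrm{d}(x)\mathrm{d}(y)}[y,x]$ and $[x,[y,z]]=[[x,y],z]+(-1)^{\mathrm{d}(x)\mathrm{d}(y)}[y,[x,z]]$. Super-biderivations. A bilinear map $\phi:L\times L\to L$ is $\mathbb{Z}_2$-homogeneous of degree $\gamma=\mathrm{d}(\phi)\in\mathbb{Z}_2$ if $\phi(L_\alpha,L_\beta)\subset L_{\alpha+\beta+\gamma}$ for all $\alpha,\beta\in\mathbb{Z}_2$.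 A homogeneous bilinear map $\phi$ is a skew-symmetric super-biderivation of $L$ if for all homogeneous $x,y,z\in L$ $$\phi(x,[y,z])=[\phi(x,y),z]+(-1)^{(\mathrm{d}(\phi)+\mathrm{d}(x))\mathrm{d}(y)}[y,\phi(x,z)],$$ $$\phi(x,y)=-(-1)^{\mathrm{d}(\phi)\mathrm{d}(x)+\mathrm{d}(\phi)\mathrm{d}(y)+\mathrm{d}(x)\mathrm{d}(y)}\phi(y,x).$$ The algebra $S(m,n;\underline{t})$. Let $\underline{t}=(t_1,\dots,t_m)$ be an $m$-tuple of positive integers, $s=m+n$, $Y_0=\{1,\dots,m\}$, $Y_1=\{m+1,\dots,s\}$, $Y=Y_0\cup Y_1$, and $\tau(i)=\bar 0$ for $i\in Y_0$, $\tau(i)=\bar 1$ for $i\in Y_1$. Let $\pi_i=p^{t_i}-1$ and $A=\{\alpha\in\mathbb{N}^m\mid 0\le\alpha_i\le\pi_i\}$; let $B$ be the set of strictly increasing tuples $u=\langle i_1,\dots,i_k\rangle$ in $Y_1$ ($0\le k\le n$), with $x^u=x_{i_1}\cdots x_{i_k}$ and $x^{\varnothing}=1$. Let $\Lambda(m,n;\underline{t})$ be the associative superalgebra with basis $\{x^{(\alpha)}x^u\mid\alpha\in A,u\in B\}$, where $x^{(\alpha)}x^{(\beta)}=\binom{\alpha+\beta}{\alpha}x^{(\alpha+\beta)}$ with $\binom{\alpha}{\beta}=\prod_i\binom{\alpha_i}{\beta_i}$ (the product is $0$ when $\alpha+\beta\notin A$), $x_ix_j=-x_jx_i$ for $i,j\in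 Y_1$ (so $x_i^2=0$), $x^{(\alpha)}x_j=x_jx^{(\alpha)}$ for $j\in Y_1$; the $x^{(\alpha)}$ are even and the $x_j$, $j\in Y_1$, odd. For $i\in Y_0$ write $x_i=x^{(\varepsilon_i)}$, with $\varepsilon_i$ the $i$-th unit vector. Let $D_i$ ($i\in Y$) be the superderivation of parity $\tau(i)$ given by $D_i(x^{(\alpha)}x^u)=x^{(\alpha-\varepsilon_i)}x^u$ for $i\in Y_0$ (zero if $\alpha_i=0$), and $D_i(x^{(\alpha)}x^u)=x^{(\alpha)}\partial_i(x^u)$ for $i\in Y_1$, where $\partial_i$ is the odd superderivation of the Grassmann algebra with $\partial_i(x_j)=\delta_{ij}$. Let $W(m,n;\underline{t})=\{\sum_{i\in Y}f_iD_i\mid f_i\in\Lambda(m,n;\underline{t})\}$ with bracket $[fD_i,gD_j]=fD_i(g)D_j-(-1)^{\mathrm{d}(fD_i)\mathrm{d}(gD_j)}gD_j(f)D_i$. For $i,j\in Y$ and homogeneous $f\in\Lambda(m,n;\underline{t})$ put $$D_{ij}(f)=-(-1)^{\mathrm{d}(f)(\tau(i)+\tau(j))}D_j(f)D_i+(-1)^{\tau(i)\tau(j)}D_i(f)D_j,$$ extended linearly in $f$. Then $S=S(m,n;\underline{t})=\mathrm{span}_{\mathbb{F}}\{D_{ij}(f)\mid i,j\in Y,\ f\in\Lambda(m,n;\underline{t})\}$, a finite-dimensional simple Lie sub-superalgebra of $W(m,n;\underline{t})$. *)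

theory Defs
  imports Main "HOL.Vector_Spaces" "HOL-Library.Function_Algebras" "HOL-Library.Z2"
begin

section \<open>Super-biderivations\<close>

definition sgn2 :: "bit \<Rightarrow> 'a::ring_1"  \<comment> \<open>\<open>(-1)\<^sup>d\<close> for \<open>d\<close> in \<open>\<int>\<^sub>2\<close>\<close>
  where "sgn2 d = (if d = 0 then 1 else - 1)"

definition bilinear_on ::
  "('a \<Rightarrow> 'v \<Rightarrow> 'v) \<Rightarrow> 'v::ab_group_add set \<Rightarrow> ('v \<Rightarrow> 'v \<Rightarrow> 'v) \<Rightarrow> bool"
  where "bilinear_on scale L \<phi> \<longleftrightarrow>
    (\<forall>x\<in>L. \<forall>y\<in>L. \<phi> x y \<in> L) \<and>
    (\<forall>x\<in>L. \<forall>y\<in>L. \<forall>z\<in>L. \<phi> (x + y) z = \<phi> x z + \<phi> y z \<and> \<phi> x (y + z) = \<phi> x y + \<phi> x z) \<and>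
    (\<forall>c. \<forall>x\<in>L. \<forall>y\<in>L. \<phi> (scale c x) y = scale c (\<phi> x y) \<and> \<phi> x (scale c y) = scale c (\<phi> x y))"

text \<open>
  The superspace is given by its carrier \<open>L\<close> and its homogeneous components \<open>Lh 0\<close> and \<open>Lh 1\<close>.
  An identity involving degrees is quantified over the degrees \<open>\<alpha>\<close>, \<open>\<beta>\<close> and over elements
  of the corresponding components. Values of \<open>\<phi>\<close> outside \<open>L\<close> are irrelevant.
\<close>

definition homogeneous_bilinear_map ::
  "('a \<Rightarrow> 'v \<Rightarrow> 'v) \<Rightarrow> 'v::ab_group_add set \<Rightarrow> (bit \<Rightarrow> 'v set) \<Rightarrow> bit \<Rightarrow> ('v \<Rightarrow> 'v \<Rightarrow> 'v) \<Rightarrow> bool"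
  where "homogeneous_bilinear_map scale L Lh \<gamma> \<phi> \<longleftrightarrow>
    bilinear_on scale L \<phi> \<and>
    (\<forall>\<alpha> \<beta>. \<forall>x\<in>Lh \<alpha>. \<forall>y\<in>Lh \<beta>. \<phi> x y \<in> Lh (\<alpha> + \<beta> + \<gamma>))"

definition skew_super_biderivation ::
  "('a::ring_1 \<Rightarrow> 'v \<Rightarrow> 'v) \<Rightarrow> 'v::ab_group_add set \<Rightarrow> (bit \<Rightarrow> 'v set) \<Rightarrow> ('v \<Rightarrow> 'v \<Rightarrow> 'v) \<Rightarrow>
    ('v \<Rightarrow> 'v \<Rightarrow> 'v) \<Rightarrow> bool"
  where "skew_super_biderivation scale L Lh br \<phi> \<longleftrightarrow>
    (\<exists>\<gamma>. homogeneous_bilinear_map scale L Lh \<gamma> \<phi> \<and>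
      (\<forall>\<alpha> \<beta> \<delta>. \<forall>x\<in>Lh \<alpha>. \<forall>y\<in>Lh \<beta>. \<forall>z\<in>Lh \<delta>.
        \<phi> x (br y z) = br (\<phi> x y) z + scale (sgn2 ((\<gamma> + \<alpha>) * \<beta>)) (br y (\<phi> x z))) \<and>
      (\<forall>\<alpha> \<beta>. \<forall>x\<in>Lh \<alpha>. \<forall>y\<in>Lh \<beta>.
        \<phi> x y = - scale (sgn2 (\<gamma> * \<alpha> + \<gamma> * \<beta> + \<alpha> * \<beta>)) (\<phi> y x)))"


section \<open>The associative superalgebra \<open>\<Lambda>(m,n;t)\<close>\<close>

definition Y0 :: "nat \<Rightarrow> nat set"
  where "Y0 m = {1..m}"

definition Y1 :: "nat \<Rightarrow> nat \<Rightarrow> nat set"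
  where "Y1 m n = {m + 1..m + n}"

definition Y :: "nat \<Rightarrow> nat \<Rightarrow> nat set"
  where "Y m n = Y0 m \<union> Y1 m n"

definition tau :: "nat \<Rightarrow> nat \<Rightarrow> bit"
  where "tau m i = (if i \<in> Y0 m then 0 else 1)"

text \<open>
  A pair \<open>(\<alpha>, u)\<close> encodes the basis element \<open>x\<^sup>(\<^sup>\<alpha>\<^sup>) x\<^sup>u\<close>: the multi-index \<open>\<alpha>\<close> is extended by zero
  outside \<open>Y0 m\<close>, and a strictly increasing tuple \<open>u\<close> in \<open>Y1 m n\<close> is represented by the set of
  its entries.
\<close>

type_synonym monom = "(nat \<Rightarrow> nat) \<times> nat set"

definition A_set :: "nat \<Rightarrow> nat \<Rightarrow> (nat \<Rightarrow> nat) \<Rightarrow> (nat \<Rightarrow> nat) set"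
  where "A_set p m t = {\<alpha>. (\<forall>i\<in>Y0 m. \<alpha> i \<le> p ^ t i - 1) \<and> (\<forall>i. i \<notin> Y0 m \<longrightarrow> \<alpha> i = 0)}"

definition B_set :: "nat \<Rightarrow> nat \<Rightarrow> nat set set"
  where "B_set m n = Pow (Y1 m n)"

definition monoms :: "nat \<Rightarrow> nat \<Rightarrow> nat \<Rightarrow> (nat \<Rightarrow> nat) \<Rightarrow> monom set"
  where "monoms p m n t = A_set p m t \<times> B_set m n"

definition monom_parity :: "monom \<Rightarrow> bit"
  where "monom_parity a = of_nat (card (snd a))"

text \<open>
  Elements of \<open>\<Lambda>(m,n;t)\<close> are coefficient functions supported on the basis; the characteristic
  \<open>p\<close> is that of the coefficient field.
\<close>

type_synonym 'a lam = "monom \<Rightarrow> 'a"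

definition Lam :: "nat \<Rightarrow> nat \<Rightarrow> (nat \<Rightarrow> nat) \<Rightarrow> 'a::field lam set"
  where "Lam m n t = {f. \<forall>a. a \<notin> monoms CHAR('a) m n t \<longrightarrow> f a = 0}"

definition lscale :: "'a::field \<Rightarrow> 'a lam \<Rightarrow> 'a lam"
  where "lscale c f = (\<lambda>a. c * f a)"

definition basis_elem :: "monom \<Rightarrow> 'a::field lam"
  where "basis_elem a = (\<lambda>b. if b = a then 1 else 0)"

definition lam_part :: "bit \<Rightarrow> 'a::field lam \<Rightarrow> 'a lam"  \<comment> \<open>homogeneous component of degree \<open>d\<close>\<close>
  where "lam_part d f = (\<lambda>a. if monom_parity a = d then f a else 0)"

text \<open>
  \<open>x\<^sup>u x\<^sup>v\<close> vanishes if \<open>u\<close> and \<open>v\<close> share an index (\<open>x\<^sub>i\<^sup>2 = 0\<close>); otherwise, sorting the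
  concatenation costs one sign for each pair in \<open>u \<times> v\<close> that is out of order.
\<close>

definition monom_mult ::
  "nat \<Rightarrow> nat \<Rightarrow> (nat \<Rightarrow> nat) \<Rightarrow> monom \<Rightarrow> monom \<Rightarrow> 'a::field lam"
  where "monom_mult m n t = (\<lambda>(\<alpha>, u) (\<beta>, v).
    if \<alpha> + \<beta> \<in> A_set CHAR('a) m t \<and> u \<inter> v = {}
    then lscale (of_nat (\<Prod>i\<in>Y0 m. (\<alpha> i + \<beta> i) choose \<alpha> i) *
                 (- 1) ^ card {(i, j). i \<in> u \<and> j \<in> v \<and> j < i})
           (basis_elem (\<alpha> + \<beta>, u \<union> v))
    else 0)"

definition lam_mult ::
  "nat \<Rightarrow> nat \<Rightarrow> (nat \<Rightarrow> nat) \<Rightarrow> 'a::field lam \<Rightarrow> 'a lam \<Rightarrow> 'a lam"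
  where "lam_mult m n t f g =
    (\<Sum>a\<in>monoms CHAR('a) m n t. \<Sum>b\<in>monoms CHAR('a) m n t.
      lscale (f a * g b) (monom_mult m n t a b))"

definition X :: "nat \<Rightarrow> nat \<Rightarrow> 'a::field lam"  \<comment> \<open>the generator \<open>x\<^sub>i\<close>\<close>
  where "X m i = (if i \<in> Y0 m then basis_elem ((\<lambda>j. if j = i then 1 else 0), {})
                  else basis_elem (0, {i}))"

text \<open>
  For odd \<open>i\<close> the superderivation rule for \<open>\<partial>\<^sub>i\<close> moves it past the factors of \<open>x\<^sup>u\<close> that
  precede \<open>x\<^sub>i\<close>, each of which contributes a sign.
\<close>

definition D_monom :: "nat \<Rightarrow> nat \<Rightarrow> monom \<Rightarrow> 'a::field lam"
  where "D_monom m i = (\<lambda>(\<alpha>, u).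
    if i \<in> Y0 m then (if \<alpha> i = 0 then 0 else basis_elem (\<alpha>(i := \<alpha> i - 1), u))
    else (if i \<in> u then lscale ((- 1) ^ card {j \<in> u. j < i}) (basis_elem (\<alpha>, u - {i})) else 0))"

definition D :: "nat \<Rightarrow> nat \<Rightarrow> (nat \<Rightarrow> nat) \<Rightarrow> nat \<Rightarrow> 'a::field lam \<Rightarrow> 'a lam"
  where "D m n t i f = (\<Sum>a\<in>monoms CHAR('a) m n t. lscale (f a) (D_monom m i a))"


section \<open>The Lie superalgebras \<open>W(m,n;t)\<close> and \<open>S(m,n;t)\<close>\<close>

text \<open>
  Since \<open>D\<^sub>i(x\<^sub>j) = \<delta>\<^sub>i\<^sub>j\<close>, the \<open>D\<^sub>i\<close> are linearly independent over \<open>\<Lambda>(m,n;t)\<close>, and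
  \<open>\<Sum>\<^sub>i f\<^sub>i D\<^sub>i\<close> is represented by its coefficient family \<open>i \<mapsto> f\<^sub>i\<close>, zero outside \<open>Y m n\<close>.
\<close>

type_synonym 'a wfam = "nat \<Rightarrow> 'a lam"

definition W :: "nat \<Rightarrow> nat \<Rightarrow> (nat \<Rightarrow> nat) \<Rightarrow> 'a::field wfam set"
  where "W m n t = {w. (\<forall>i\<in>Y m n. w i \<in> Lam m n t) \<and> (\<forall>i. i \<notin> Y m n \<longrightarrow> w i = 0)}"

definition wscale :: "'a::field \<Rightarrow> 'a wfam \<Rightarrow> 'a wfam"
  where "wscale c w = (\<lambda>i. lscale c (w i))"

lemma vector_space_wscale: "vector_space wscale"
  by unfold_locales (auto simp: wscale_def lscale_def fun_eq_iff algebra_simps)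

definition fD :: "'a::field lam \<Rightarrow> nat \<Rightarrow> 'a wfam"  \<comment> \<open>\<open>f D\<^sub>i\<close>\<close>
  where "fD f i = (\<lambda>j. if j = i then f else 0)"

text \<open>\<open>f D\<^sub>i\<close> has degree \<open>d(f) + \<tau>(i)\<close>.\<close>

definition W_hom :: "nat \<Rightarrow> nat \<Rightarrow> (nat \<Rightarrow> nat) \<Rightarrow> bit \<Rightarrow> 'a::field wfam set"
  where "W_hom m n t \<gamma> = {w \<in> W m n t. \<forall>i\<in>Y m n. lam_part (\<gamma> + tau m i) (w i) = w i}"

text \<open>
  \<open>[f D\<^sub>i, g D\<^sub>j]\<close> for \<open>f\<close>, \<open>g\<close> of degrees \<open>a\<close>, \<open>b\<close>, extended bilinearly by splitting
  coefficients into their homogeneous components.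
\<close>

definition W_bracket_hom ::
  "nat \<Rightarrow> nat \<Rightarrow> (nat \<Rightarrow> nat) \<Rightarrow> bit \<Rightarrow> 'a::field lam \<Rightarrow> nat \<Rightarrow> bit \<Rightarrow> 'a lam \<Rightarrow> nat \<Rightarrow> 'a wfam"
  where "W_bracket_hom m n t a f i b g j =
    fD (lam_mult m n t f (D m n t i g)) j
    - wscale (sgn2 ((a + tau m i) * (b + tau m j))) (fD (lam_mult m n t g (D m n t j f)) i)"

definition W_bracket ::
  "nat \<Rightarrow> nat \<Rightarrow> (nat \<Rightarrow> nat) \<Rightarrow> 'a::field wfam \<Rightarrow> 'a wfam \<Rightarrow> 'a wfam"
  where "W_bracket m n t v w =
    (\<Sum>i\<in>Y m n. \<Sum>j\<in>Y m n. \<Sum>a\<in>{0, 1}. \<Sum>b\<in>{0, 1}.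
      W_bracket_hom m n t a (lam_part a (v i)) i b (lam_part b (w j)) j)"

definition Dij :: "nat \<Rightarrow> nat \<Rightarrow> (nat \<Rightarrow> nat) \<Rightarrow> nat \<Rightarrow> nat \<Rightarrow> 'a::field lam \<Rightarrow> 'a wfam"
  where "Dij m n t i j f =
    (\<Sum>d\<in>{0, 1}.
      - wscale (sgn2 (d * (tau m i + tau m j))) (fD (D m n t j (lam_part d f)) i)
      + wscale (sgn2 (tau m i * tau m j)) (fD (D m n t i (lam_part d f)) j))"

definition S :: "nat \<Rightarrow> nat \<Rightarrow> (nat \<Rightarrow> nat) \<Rightarrow> 'a::field wfam set"
  where "S m n t = module.span wscale {Dij m n t i j f | i j f. i \<in> Y m n \<and> j \<in> Y m n \<and> f \<in> Lam m n t}"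

definition S_hom :: "nat \<Rightarrow> nat \<Rightarrow> (nat \<Rightarrow> nat) \<Rightarrow> bit \<Rightarrow> 'a::field wfam set"
  where "S_hom m n t \<gamma> = S m n t \<inter> W_hom m n t \<gamma>"

end

theory Submission
  imports Defs
begin

text \<open>
  The elements \<open>H = x\<^sub>kD\<^sub>k + x\<^sub>lD\<^sub>l\<close> (\<open>k\<close> even, \<open>l\<close> odd) span an abelian even subalgebra \<open>T\<close> acting
  diagonally, and the second argument in the theorem is \<open>-E\<close> with \<open>E = x\<^sub>kD\<^sub>i\<close>, whatever \<open>j\<^sub>1\<close> is. Expanding
  \<open>\<phi>([x,u],w) = 0\<close> for \<open>x\<close>, \<open>u\<close> in \<open>T\<close> gives \<open>[x,\<phi>(u,w)] = [u,\<phi>(x,w)]\<close>. This forces \<open>\<phi>(T,T) = 0\<close>, so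
  \<open>\<phi>(x,\<cdot>)\<close> preserves weights, and \<open>x(w) \<phi>(u,w) = u(w) \<phi>(x,w)\<close> for a vector \<open>w\<close> of weight
  \<open>x \<mapsto> x(w)\<close>; in particular \<open>\<phi>(x,D\<^sub>e) = 0\<close> when \<open>D\<^sub>e\<close> commutes with \<open>x\<close>.
  Put \<open>z = \<phi>(H,E)\<close>, which agrees up to sign with \<open>\<phi>(x\<^sub>rD\<^sub>r + x\<^sub>iD\<^sub>i, E)\<close> for an even \<open>r \<noteq> k\<close>. Using the
  first argument that commutes with \<open>D\<^sub>e\<close> one gets \<open>[D\<^sub>e,z] = 0\<close> for \<open>e \<noteq> k\<close> and \<open>[D\<^sub>k,[D\<^sub>k,z]] = 0\<close>, so
  the coefficients of \<open>z\<close> are affine in \<open>x\<^sub>k\<close>, and the weight of \<open>z\<close> leaves only multiples of \<open>E\<close>.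
\<close>


section \<open>Coefficients in \<open>\<Lambda>(m,n;t)\<close>\<close>

definition eps :: "nat \<Rightarrow> nat \<Rightarrow> nat"
  where "eps k = (\<lambda>j. if j = k then 1 else 0)"

abbreviation one_lam :: "'a::field lam"
  where "one_lam \<equiv> basis_elem (0, {})"

lemma eps_simps [simp]: "eps k k = 1" "i \<noteq> k \<Longrightarrow> eps k i = 0"
  by (simp_all add: eps_def)

lemma sum_fun_apply: "(\<Sum>a\<in>A. f a) x = (\<Sum>a\<in>A. f a x)"
  by (induction A rule: infinite_finite_induct) auto

lemma card_less_self: "card {i. i = j \<and> i < (j :: nat)} = 0"
  by (simp add: card_eq_0_iff)

lemma finite_Y: "finite (Y m n)"
  by (simp add: Y_def Y0_def Y1_def)

lemma Y0_in_Y: "i \<in> Y0 m \<Longrightarrow> i \<in> Y m n"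
  and Y1_in_Y: "i \<in> Y1 m n \<Longrightarrow> i \<in> Y m n"
  and Y1_notin_Y0: "i \<in> Y1 m n \<Longrightarrow> i \<notin> Y0 m"
  by (auto simp: Y_def Y0_def Y1_def)

lemma tau_simps: "i \<in> Y0 m \<Longrightarrow> tau m i = 0" "i \<in> Y1 m n \<Longrightarrow> tau m i = 1"
  by (auto simp: tau_def Y0_def Y1_def)

lemma finite_monoms: "finite (monoms p m n t)"
proof -
  \<comment> \<open>One bound for all coordinates places the multi-indices among the functions from
    a finite set to a finite set, extended by zero.\<close>
  let ?M = "\<Sum>i\<in>Y0 m. p ^ t i"
  have "A_set p m t \<subseteq> {f. \<forall>i. (i \<in> Y0 m \<longrightarrow> f i \<in> {..?M}) \<and> (i \<notin> Y0 m \<longrightarrow> f i = 0)}"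
  proof -
    have "f i \<le> ?M" if "f \<in> A_set p m t" "i \<in> Y0 m" for f i
    proof -
      have "f i \<le> p ^ t i" using that by (force simp: A_set_def)
      also have "\<dots> \<le> ?M" using that(2) by (intro member_le_sum) (auto simp: Y0_def)
      finally show ?thesis .
    qed
    then show ?thesis by (auto simp: A_set_def)
  qed
  moreover have "finite \<dots>"
    by (rule finite_set_of_finite_funs) (auto simp: Y0_def)
  ultimately have "finite (A_set p m t)" by (rule finite_subset)
  then show ?thesis by (simp add: monoms_def B_set_def Y1_def)
qed

lemma Lam_zero: "f \<in> Lam m n t \<Longrightarrow> a \<notin> monoms CHAR('a::field) m n t \<Longrightarrow> (f :: 'a lam) a = 0"
  unfolding Lam_def by blast

lemma basis_elem_in_Lam: "a \<in> monoms CHAR('a::field) m n t \<Longrightarrow> (basis_elem a :: 'a lam) \<in> Lam m n t"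
  by (auto simp: Lam_def basis_elem_def)

lemma lam_part_basis: "lam_part d (basis_elem a) = (if monom_parity a = d then basis_elem a else 0)"
  by (auto simp: lam_part_def basis_elem_def fun_eq_iff)

section \<open>Partial derivatives, coefficient by coefficient\<close>

lemma D_zero [simp]: "D m n t i 0 = 0"
  by (simp add: D_def lscale_def fun_eq_iff sum_fun_apply)

lemma D_sum_parts: "D m n t i (lam_part 0 f) + D m n t i (lam_part 1 f) = D m n t i f"
  by (auto simp: D_def lam_part_def fun_eq_iff lscale_def sum_fun_apply simp flip: sum.distrib
      intro!: sum.cong)

lemma D_basis:
  assumes "a \<in> monoms CHAR('a::field) m n t"
  shows "D m n t i (basis_elem a) = (D_monom m i a :: 'a lam)"
proof -
  have "D m n t i (basis_elem a) b = (\<Sum>c\<in>monoms CHAR('a) m n t. if c = a then (D_monom m i a b :: 'a) else 0)"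
    for b
    unfolding D_def by (auto simp: sum_fun_apply lscale_def basis_elem_def intro!: sum.cong)
  then show ?thesis using assms finite_monoms[of "CHAR('a)" m n t] by (simp add: fun_eq_iff)
qed

text \<open>Divided powers make \<open>D_i\<close> a pure shift of coefficients: exactly one basis
  monomial is sent to \<open>(\<alpha>, u)\<close>, with factor 1.\<close>

lemma D_even:
  fixes f :: "'a::field lam"
  assumes "f \<in> Lam m n t" "i \<in> Y0 m"
  shows "D m n t i f (\<alpha>, u) = f (\<alpha>(i := \<alpha> i + 1), u)"
proof -
  have "(D_monom m i a (\<alpha>, u) :: 'a) = (if a = (\<alpha>(i := \<alpha> i + 1), u) then 1 else 0)" for a
  proof (cases a)
    case (Pair \<beta> v)
    have "\<beta> i \<noteq> 0 \<and> \<alpha> = \<beta>(i := \<beta> i - 1) \<longleftrightarrow> \<beta> = \<alpha>(i := \<alpha> i + 1)"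
      by (auto simp: fun_upd_idem_iff)
    then show ?thesis using assms(2) Pair by (auto simp: D_monom_def basis_elem_def)
  qed
  then have "D m n t i f (\<alpha>, u) =
      (\<Sum>a\<in>monoms CHAR('a) m n t. if a = (\<alpha>(i := \<alpha> i + 1), u) then f a else 0)"
    unfolding D_def by (auto simp: sum_fun_apply lscale_def intro!: sum.cong)
  then show ?thesis using assms Lam_zero[OF assms(1)] by (simp add: finite_monoms)
qed

lemma D_odd:
  fixes f :: "'a::field lam"
  assumes "f \<in> Lam m n t" "i \<notin> Y0 m"
  shows "D m n t i f (\<alpha>, u) = (if i \<in> u then 0 else (-1) ^ card {j\<in>u. j < i} * f (\<alpha>, insert i u))"
proof -
  have mon: "(D_monom m i a (\<alpha>, u) :: 'a) =
      (if a = (\<alpha>, insert i u) then if i \<in> u then 0 else (-1) ^ card {j\<in>u. j < i} else 0)" for a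
  proof (cases a)
    case (Pair \<beta> v)
    have "{j. (j = i \<or> j \<in> u) \<and> j < i} = {j \<in> u. j < i}" by auto
    then show ?thesis
      using assms(2) Pair by (auto simp: D_monom_def basis_elem_def lscale_def fun_eq_iff insert_absorb)
  qed
  then have "D m n t i f (\<alpha>, u) =
      (\<Sum>a\<in>monoms CHAR('a) m n t. if a = (\<alpha>, insert i u)
         then f a * (if i \<in> u then 0 else (-1) ^ card {j\<in>u. j < i}) else 0)"
    unfolding D_def sum_fun_apply lscale_def by (intro sum.cong refl) (simp add: mon)
  then show ?thesis using assms Lam_zero[OF assms(1)] by (simp add: finite_monoms)
qed

text \<open>Raising an exponent or adding an odd index never leads from outside the basis back into
  it.\<close>

lemma D_in_Lam:
  fixes f :: "'a::field lam"
  assumes "f \<in> Lam m n t" "i \<in> Y m n"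
  shows "D m n t i f \<in> Lam m n t"
proof -
  have "D m n t i f (\<alpha>, u) = 0" if "(\<alpha>, u) \<notin> monoms CHAR('a) m n t" for \<alpha> u
  proof (cases "i \<in> Y0 m")
    case True
    have "(\<alpha>(i := \<alpha> i + 1), u) \<notin> monoms CHAR('a) m n t"
      using that True by (auto simp: monoms_def A_set_def split: if_splits)
        (metis Suc_leD)+
    then show ?thesis using D_even[OF assms(1) True] Lam_zero[OF assms(1)] by simp
  next
    case False
    have "(\<alpha>, insert i u) \<notin> monoms CHAR('a) m n t"
      using that by (auto simp: monoms_def B_set_def)
    then show ?thesis using D_odd[OF assms(1) False] Lam_zero[OF assms(1)] by simp
  qed
  then show ?thesis by (auto simp: Lam_def)
qed

section \<open>Products with basis elements\<close>

lemma lam_mult_zero [simp]: "lam_mult m n t 0 g = 0" "lam_mult m n t f 0 = 0"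
  by (simp_all add: lam_mult_def lscale_def fun_eq_iff sum_fun_apply)

lemma lam_mult_add_right: "lam_mult m n t f (g + h) = lam_mult m n t f g + lam_mult m n t f h"
  by (simp add: lam_mult_def lscale_def fun_eq_iff sum_fun_apply algebra_simps sum.distrib)

lemma lam_mult_add_left: "lam_mult m n t (g + h) f = lam_mult m n t g f + lam_mult m n t h f"
  by (simp add: lam_mult_def lscale_def fun_eq_iff sum_fun_apply algebra_simps sum.distrib)

lemma lam_mult_basis_left:
  assumes "a \<in> monoms CHAR('a::field) m n t"
  shows "lam_mult m n t (basis_elem a) (g :: 'a lam) c =
    (\<Sum>b\<in>monoms CHAR('a) m n t. g b * monom_mult m n t a b c)"
proof -
  have "lam_mult m n t (basis_elem a) g c =
      (\<Sum>a'\<in>monoms CHAR('a) m n t. if a' = a then \<Sum>b\<in>monoms CHAR('a) m n t. g b * monom_mult m n t a b c else 0)"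
    unfolding lam_mult_def
    by (auto simp: sum_fun_apply lscale_def basis_elem_def intro!: sum.cong)
  then show ?thesis using assms by (simp add: finite_monoms)
qed

lemma lam_mult_basis_right:
  assumes "b \<in> monoms CHAR('a::field) m n t"
  shows "lam_mult m n t (g :: 'a lam) (basis_elem b) c =
    (\<Sum>a\<in>monoms CHAR('a) m n t. g a * monom_mult m n t a b c)"
proof -
  have "(\<Sum>b'\<in>monoms CHAR('a) m n t. lscale (g a * basis_elem b b') (monom_mult m n t a b')) c
      = g a * monom_mult m n t a b c" for a
  proof -
    have "(\<Sum>b'\<in>monoms CHAR('a) m n t. lscale (g a * basis_elem b b') (monom_mult m n t a b')) c
      = (\<Sum>b'\<in>monoms CHAR('a) m n t. if b' = b then g a * monom_mult m n t a b c else 0)"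
      by (auto simp: sum_fun_apply lscale_def basis_elem_def intro!: sum.cong)
    then show ?thesis using assms by (simp add: finite_monoms)
  qed
  then show ?thesis unfolding lam_mult_def by (simp add: sum_fun_apply)
qed

lemma lam_mult_basis:
  assumes "a \<in> monoms CHAR('a::field) m n t" "b \<in> monoms CHAR('a) m n t"
  shows "lam_mult m n t (basis_elem a) (basis_elem b :: 'a lam) = monom_mult m n t a b"
proof
  fix c
  have "lam_mult m n t (basis_elem a) (basis_elem b :: 'a lam) c =
     (\<Sum>b'\<in>monoms CHAR('a) m n t. if b' = b then monom_mult m n t a b c else 0)"
    unfolding lam_mult_basis_left[OF assms(1)] by (auto simp: basis_elem_def intro!: sum.cong)
  then show "lam_mult m n t (basis_elem a) (basis_elem b :: 'a lam) c = monom_mult m n t a b c"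
    using assms by (simp add: finite_monoms)
qed

lemma one_in_monoms: "(0, {}) \<in> monoms p m n t"
  by (simp add: monoms_def A_set_def B_set_def)

lemma odd_in_monoms: "l \<in> Y1 m n \<Longrightarrow> (0, {l}) \<in> monoms p m n t"
  by (simp add: monoms_def B_set_def A_set_def)

lemma lam_mult_one_left:
  fixes g :: "'a::field lam"
  assumes "g \<in> Lam m n t"
  shows "lam_mult m n t one_lam g = g"
proof
  fix c
  have "lam_mult m n t one_lam g c = (\<Sum>b\<in>monoms CHAR('a) m n t. if b = c then g c else 0)"
    unfolding lam_mult_basis_left[OF one_in_monoms]
    by (auto simp: monom_mult_def lscale_def basis_elem_def monoms_def intro!: sum.cong)
  then show "lam_mult m n t one_lam g c = g c"
    using Lam_zero[OF assms] by (simp add: finite_monoms)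
qed

lemma lam_mult_one_right:
  fixes g :: "'a::field lam"
  assumes "g \<in> Lam m n t"
  shows "lam_mult m n t g one_lam = g"
proof
  fix c
  have "lam_mult m n t g one_lam c = (\<Sum>b\<in>monoms CHAR('a) m n t. if b = c then g c else 0)"
    unfolding lam_mult_basis_right[OF one_in_monoms]
    by (auto simp: monom_mult_def lscale_def basis_elem_def monoms_def intro!: sum.cong)
  then show "lam_mult m n t g one_lam c = g c"
    using Lam_zero[OF assms] by (simp add: finite_monoms)
qed

lemma X_even: "k \<in> Y0 m \<Longrightarrow> X m k = (basis_elem (eps k, {}) :: 'a::field lam)"
  and X_odd: "l \<notin> Y0 m \<Longrightarrow> X m l = (basis_elem (0, {l}) :: 'a::field lam)"
  by (simp_all add: X_def eps_def)

lemma D_monom_one: "D_monom m i (0, {}) = 0"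
  by (simp add: D_monom_def)

context
  fixes p m n :: nat and t :: "nat \<Rightarrow> nat"
  assumes p: "p > 2" and t: "\<And>i. i \<in> Y0 m \<Longrightarrow> t i > 0"
begin

text \<open>As \<open>t k > 0\<close>, the bound \<open>p ^ t k - 1\<close> is at least 1, so
  \<open>x_k\<close> survives the truncation.\<close>

lemma eps_in_A_set: "k \<in> Y0 m \<Longrightarrow> eps k \<in> A_set p m t"
proof -
  assume k: "k \<in> Y0 m"
  have "p ^ 1 \<le> p ^ t k" using p t[OF k] by (intro power_increasing) auto
  then show ?thesis using p k by (auto simp: A_set_def eps_def)
qed

lemma eps_in_monoms: "k \<in> Y0 m \<Longrightarrow> u \<subseteq> Y1 m n \<Longrightarrow> (eps k, u) \<in> monoms p m n t"
  using eps_in_A_set by (simp add: monoms_def B_set_def)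

end

lemma D_monom_eps:
  assumes "k \<in> Y0 m"
  shows "D_monom m k (eps k, u) = basis_elem (0, u)"
proof -
  have "(eps k)(k := eps k k - 1) = 0" by (auto simp: eps_def)
  then show ?thesis using assms by (simp add: D_monom_def)
qed

section \<open>The operators \<open>D_i\<close> and \<open>x_iD_i\<close> on monomials\<close>

lemma D_X:
  fixes m n :: nat
  assumes "CHAR('a::field) > 2" "\<And>i. i \<in> Y0 m \<Longrightarrow> t i > 0" "j \<in> Y m n"
  shows "D m n t i (X m j :: 'a lam) = (if i = j then one_lam else 0)"
proof (cases "j \<in> Y0 m")
  case True
  have "(eps j, {}) \<in> monoms CHAR('a) m n t"
    using eps_in_monoms[of "CHAR('a)"] assms(1,2) True by blast
  then have "D m n t i (X m j :: 'a lam) = D_monom m i (eps j, {})"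
    by (simp add: X_even[OF True] D_basis)
  also have "\<dots> = (if i = j then one_lam else 0)"
    using D_monom_eps[OF True, of "{}"] by (auto simp: D_monom_def eps_def)
  finally show ?thesis .
next
  case False
  then have "j \<in> Y1 m n" using assms(3) by (simp add: Y_def)
  then have "(0, {j}) \<in> monoms CHAR('a) m n t"
    by (rule odd_in_monoms)
  then have "D m n t i (X m j :: 'a lam) = D_monom m i (0, {j})"
    by (simp add: X_odd[OF False] D_basis)
  also have "\<dots> = (if i = j then one_lam else 0)"
    using False by (auto simp: D_monom_def lscale_def card_less_self)
  finally show ?thesis .
qed

text \<open>The binomial in the divided power product gives
  \<open>x_k x^(\<alpha>-\<epsilon>_k) = \<alpha>_k x^(\<alpha>)\<close>, which makes the Euler
  operator \<open>x_kD_k\<close> diagonal on monomials.\<close>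

lemma X_D_even:
  fixes g :: "'a::field lam"
  assumes "CHAR('a) > 2" "\<And>i. i \<in> Y0 m \<Longrightarrow> t i > 0" "k \<in> Y0 m" "g \<in> Lam m n t"
  shows "lam_mult m n t (X m k) (D m n t k g) (\<alpha>, u) = of_nat (\<alpha> k) * g (\<alpha>, u)"
proof -
  have prod: "(\<Prod>i\<in>Y0 m. (eps k i + \<beta> i) choose (eps k i)) = \<beta> k + 1" for \<beta>
  proof -
    have "(\<Prod>i\<in>Y0 m. (eps k i + \<beta> i) choose (eps k i)) = (\<Prod>i\<in>Y0 m. if i = k then \<beta> k + 1 else 1)"
      by (intro prod.cong) (auto simp: eps_def)
    also have "\<dots> = \<beta> k + 1" using assms(3) by (simp add: Y0_def)
    finally show ?thesis .
  qed
  \<comment> \<open>The only exponent that \<open>x_k\<close> can lift to \<alpha>. If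
    \<open>\<alpha> k = 0\<close>, truncated subtraction returns \<alpha> itself, and the factor
    \<open>of_nat (\<alpha> k)\<close> is then zero.\<close>
  define \<alpha>' where "\<alpha>' = \<alpha>(k := \<alpha> k - 1)"
  have iff: "eps k + \<beta> = \<alpha> \<longleftrightarrow> \<alpha> k \<noteq> 0 \<and> \<beta> = \<alpha>'" for \<beta>
  proof
    assume "eps k + \<beta> = \<alpha>"
    then show "\<alpha> k \<noteq> 0 \<and> \<beta> = \<alpha>'" by (auto simp: \<alpha>'_def eps_def)
  next
    assume "\<alpha> k \<noteq> 0 \<and> \<beta> = \<alpha>'"
    then show "eps k + \<beta> = \<alpha>" by (auto simp: \<alpha>'_def eps_def)
  qed
  have mm: "(monom_mult m n t (eps k, {}) b (\<alpha>, u) :: 'a) =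
      (if b = (\<alpha>', u) then if \<alpha> \<in> A_set CHAR('a) m t then of_nat (\<alpha> k) else 0 else 0)" for b
  proof (cases b)
    case (Pair \<beta> v)
    have "(monom_mult m n t (eps k, {}) b (\<alpha>, u) :: 'a) =
       (if eps k + \<beta> = \<alpha> \<and> v = u \<and> \<alpha> \<in> A_set CHAR('a) m t then of_nat (\<beta> k + 1) else 0)"
      using prod[of \<beta>] by (auto simp: Pair monom_mult_def lscale_def basis_elem_def)
    also have "\<dots> = (if b = (\<alpha>', u) then if \<alpha> \<in> A_set CHAR('a) m t then of_nat (\<alpha> k) else 0 else 0)"
      unfolding iff by (auto simp: Pair \<alpha>'_def)
    finally show ?thesis .
  qed
  have ek: "(eps k, {}) \<in> monoms CHAR('a) m n t"
    using eps_in_monoms[of "CHAR('a)"] assms(1,2,3) by blast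
  have "lam_mult m n t (X m k) (D m n t k g) (\<alpha>, u) =
      (\<Sum>b\<in>monoms CHAR('a) m n t. if b = (\<alpha>', u) then
         D m n t k g (\<alpha>', u) * (if \<alpha> \<in> A_set CHAR('a) m t then of_nat (\<alpha> k) else 0) else 0)"
    unfolding X_even[OF assms(3)]
      lam_mult_basis_left[OF ek] mm
    by (intro sum.cong refl) auto
  also have "\<dots> = D m n t k g (\<alpha>', u) * (if \<alpha> \<in> A_set CHAR('a) m t then of_nat (\<alpha> k) else 0)"
    using Lam_zero[OF D_in_Lam[OF assms(4) Y0_in_Y[OF assms(3)]]]
    by (subst sum.delta[OF finite_monoms]) simp
  also have "\<dots> = of_nat (\<alpha> k) * g (\<alpha>, u)"
  proof (cases "\<alpha> k = 0")
    case False
    then have "D m n t k g (\<alpha>', u) = g (\<alpha>, u)"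
      unfolding D_even[OF assms(4,3)] by (simp add: \<alpha>'_def)
    moreover have "\<alpha> \<in> A_set CHAR('a) m t \<or> g (\<alpha>, u) = 0"
      using Lam_zero[OF assms(4)] by (auto simp: monoms_def)
    ultimately show ?thesis by auto
  qed simp
  finally show ?thesis .
qed

text \<open>Removing \<open>x_l\<close> and multiplying it back from the left cost the same sign,
  which squares to 1.\<close>

lemma X_D_odd:
  fixes g :: "'a::field lam"
  assumes "l \<in> Y1 m n" "g \<in> Lam m n t"
  shows "lam_mult m n t (X m l) (D m n t l g) (\<alpha>, u) = (if l \<in> u then g (\<alpha>, u) else 0)"
proof -
  have l: "l \<notin> Y0 m" using assms(1) by (rule Y1_notin_Y0)
  let ?s = "(-1) ^ card {j\<in>u - {l}. j < l} :: 'a"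
  have mm: "(monom_mult m n t (0, {l}) b (\<alpha>, u) :: 'a) =
      (if b = (\<alpha>, u - {l}) then if \<alpha> \<in> A_set CHAR('a) m t \<and> l \<in> u then ?s else 0 else 0)" for b
  proof (cases b)
    case (Pair \<beta> v)
    \<comment> \<open>With \<open>x_l\<close> as left factor, the out-of-order pairs are the entries
      of \<open>v\<close> below \<open>l\<close>.\<close>
    have "{(i, j). i \<in> {l} \<and> j \<in> v \<and> j < i} = Pair l ` {j \<in> v. j < l}" by auto
    then have c: "card {(i, j). i \<in> {l} \<and> j \<in> v \<and> j < i} = card {j \<in> v. j < l}"
      by (simp only: card_image[of "Pair l"] inj_on_def prod.inject simp_thms ball_simps)
    have mm': "(monom_mult m n t (0, {l}) b (\<alpha>, u) :: 'a) =
      (if \<beta> \<in> A_set CHAR('a) m t \<and> l \<notin> v \<and> \<alpha> = \<beta> \<and> u = insert l v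
       then (-1) ^ card {j \<in> v. j < l} else 0)"
      unfolding Pair monom_mult_def prod.case c by (simp add: lscale_def basis_elem_def)
    have "l \<notin> v \<and> u = insert l v \<longleftrightarrow> v = u - {l} \<and> l \<in> u" by auto
    then show ?thesis
      unfolding mm' by (auto simp: Pair)
  qed
  have ol: "(0, {l}) \<in> monoms CHAR('a) m n t" using odd_in_monoms[OF assms(1)] .
  have "lam_mult m n t (X m l) (D m n t l g) (\<alpha>, u) =
      (\<Sum>b\<in>monoms CHAR('a) m n t. if b = (\<alpha>, u - {l}) then
         D m n t l g (\<alpha>, u - {l}) * (if \<alpha> \<in> A_set CHAR('a) m t \<and> l \<in> u then ?s else 0) else 0)"
    unfolding X_odd[OF l] lam_mult_basis_left[OF ol] mm by (intro sum.cong refl) auto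
  also have "\<dots> = D m n t l g (\<alpha>, u - {l}) * (if \<alpha> \<in> A_set CHAR('a) m t \<and> l \<in> u then ?s else 0)"
    using Lam_zero[OF D_in_Lam[OF assms(2) Y1_in_Y[OF assms(1)]]]
    by (subst sum.delta[OF finite_monoms]) simp
  also have "\<dots> = (if l \<in> u then g (\<alpha>, u) else 0)"
  proof (cases "l \<in> u")
    case True
    then have "D m n t l g (\<alpha>, u - {l}) = ?s * g (\<alpha>, u)"
      unfolding D_odd[OF assms(2) l] by (simp add: insert_absorb)
    moreover have "\<alpha> \<in> A_set CHAR('a) m t \<or> g (\<alpha>, u) = 0"
      using Lam_zero[OF assms(2)] by (auto simp: monoms_def)
    moreover have "?s * ?s = 1" by (simp flip: power_mult_distrib)
    ultimately show ?thesis using True by (auto simp: ac_simps)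
  qed simp
  finally show ?thesis .
qed


section \<open>Brackets with elements of degree at most zero\<close>

lemma sgn2_simps [simp]: "sgn2 0 = 1" "sgn2 1 = - 1"
  by (simp_all add: sgn2_def)

lemma fD_zero [simp]: "fD 0 i = 0"
  by (simp add: fD_def fun_eq_iff)

lemma lam_part_zero [simp]: "lam_part d 0 = 0"
  by (simp add: lam_part_def fun_eq_iff)

lemma lam_part_in_Lam: "f \<in> Lam m n t \<Longrightarrow> lam_part d f \<in> Lam m n t"
  by (simp add: Lam_def lam_part_def)

lemma lam_part_plus: "lam_part d (f + g) = lam_part d f + lam_part d g"
  by (simp add: lam_part_def fun_eq_iff)

lemma lam_part_add: "lam_part 0 f + lam_part 1 f = f"
  by (auto simp: lam_part_def fun_eq_iff)

lemma lam_part_lam_part: "lam_part d (lam_part e f) = (if d = e then lam_part e f else 0)"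
  by (auto simp: lam_part_def fun_eq_iff)

lemma W_Lam: "w \<in> W m n t \<Longrightarrow> w i \<in> Lam m n t"
  by (cases "i \<in> Y m n") (auto simp: W_def Lam_def)

lemma fD_in_W: "f \<in> Lam m n t \<Longrightarrow> i \<in> Y m n \<Longrightarrow> fD f i \<in> W m n t"
  by (auto simp: W_def fD_def Lam_def)

lemma W_hom_add: "v \<in> W_hom m n t \<gamma> \<Longrightarrow> w \<in> W_hom m n t \<gamma> \<Longrightarrow> v + w \<in> W_hom m n t \<gamma>"
  by (auto simp: W_hom_def W_def Lam_def lam_part_plus)

lemma fD_in_W_hom:
  "f \<in> Lam m n t \<Longrightarrow> i \<in> Y m n \<Longrightarrow> lam_part (\<gamma> + tau m i) f = f \<Longrightarrow> fD f i \<in> W_hom m n t \<gamma>"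
  using fD_in_W[of f m n t i] unfolding W_hom_def fD_def by auto

lemma sum_fD: "(\<Sum>j\<in>A. fD (f j) j) = (\<lambda>j. if j \<in> A then f j else 0)" if "finite A"
  using that by (simp add: fD_def fun_eq_iff sum_fun_apply)

section \<open>Brackets of \<open>D_i\<close> and \<open>x_iD_i\<close> with arbitrary elements of
  W\<close>

lemma W_bracket_hom_zero [simp]:
  "W_bracket_hom m n t a 0 i b g j = 0" "W_bracket_hom m n t a f i b 0 j = 0"
  by (simp_all add: W_bracket_hom_def wscale_def lscale_def fun_eq_iff)

lemma W_bracket_zero [simp]: "W_bracket m n t 0 w = 0" "W_bracket m n t v 0 = 0"
  by (simp_all add: W_bracket_def)

text \<open>One homogeneous term on the left collapses two of the four sums; the parity sum on the
  right remains, since \<open>w\<close> may be inhomogeneous.\<close>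

lemma W_bracket_fD:
  assumes "lam_part d f = f" "i \<in> Y m n"
  shows "W_bracket m n t (fD f i) w =
    (\<Sum>j\<in>Y m n. \<Sum>b\<in>{0, 1}. W_bracket_hom m n t d f i b (lam_part b (w j)) j)"
proof -
  have f: "lam_part a f = (if a = d then f else 0)" for a
    using lam_part_lam_part[of a d f] assms(1) by simp
  let ?H = "\<lambda>i' j a. \<Sum>b\<in>{0, 1}. W_bracket_hom m n t a (lam_part a (fD f i i')) i' b (lam_part b (w j)) j"
  have "W_bracket m n t (fD f i) w = (\<Sum>i'\<in>Y m n. if i' = i then \<Sum>j\<in>Y m n. \<Sum>a\<in>{0, 1}. ?H i j a else 0)"
    unfolding W_bracket_def by (intro sum.cong refl) (simp add: fD_def)
  also have "\<dots> = (\<Sum>j\<in>Y m n. \<Sum>a\<in>{0, 1}. ?H i j a)"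
    using assms(2) by (simp add: finite_Y)
  also have "\<dots> = (\<Sum>j\<in>Y m n. ?H i j d)"
    by (rule sum.cong, rule refl) (cases d; simp add: fD_def f)
  finally show ?thesis using assms(1) by (simp add: fD_def)
qed

text \<open>\<open>D_j(1) = 0\<close> removes the second half of the bracket together with its
  sign.\<close>

lemma W_bracket_D:
  fixes w :: "'a::field wfam"
  assumes "i \<in> Y m n" "w \<in> W m n t"
  shows "W_bracket m n t (fD one_lam i) w = (\<lambda>j. D m n t i (w j))"
proof -
  have par: "lam_part 0 one_lam = (one_lam :: 'a lam)"
    by (simp add: lam_part_basis monom_parity_def)
  have "(\<Sum>b\<in>{0, 1}. W_bracket_hom m n t 0 one_lam i b (lam_part b (w j)) j) = fD (D m n t i (w j)) j" for j
  proof -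
    have "W_bracket_hom m n t 0 one_lam i b (lam_part b (w j)) j = fD (D m n t i (lam_part b (w j))) j" for b
      unfolding W_bracket_hom_def D_basis[OF one_in_monoms] D_monom_one
        lam_mult_one_left[OF D_in_Lam[OF lam_part_in_Lam[OF W_Lam[OF assms(2)]] assms(1)]]
      by (simp add: wscale_def lscale_def fun_eq_iff)
    moreover have "fD (g + h) j = fD g j + fD h j" for g h :: "'a lam"
      by (simp add: fD_def fun_eq_iff)
    ultimately show ?thesis using D_sum_parts[of m n t i "w j"] by simp metis
  qed
  note sum_b = this
  have "w j = 0" if "j \<notin> Y m n" for j using assms(2) that by (simp add: W_def)
  then show ?thesis
    unfolding W_bracket_fD[OF par assms(1)] sum_b sum_fD[OF finite_Y] by auto
qed

text \<open>Since \<open>D_j(x_i)\<close> is 1 for \<open>j = i\<close> and 0 otherwise, the second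
  half of the bracket survives only at \<open>j = i\<close>. Its sign is trivial because
  \<open>x_iD_i\<close> is even.\<close>

lemma W_bracket_XD:
  fixes w :: "'a::field wfam"
  assumes "CHAR('a) > 2" "\<And>i. i \<in> Y0 m \<Longrightarrow> t i > 0" "i \<in> Y m n" "w \<in> W m n t"
  shows "W_bracket m n t (fD (X m i) i) w =
    (\<lambda>j. lam_mult m n t (X m i) (D m n t i (w j)) - (if j = i then w j else 0))"
proof -
  have par: "lam_part (tau m i) (X m i) = (X m i :: 'a lam)"
    by (auto simp: X_def tau_def lam_part_basis monom_parity_def)
  have DX: "D m n t j (X m i :: 'a lam) = (if j = i then one_lam else 0)" for j
    by (rule D_X) (use assms in auto)
  have self: "tau m i + tau m i = 0" by (cases "tau m i") simp_all
  have "(\<Sum>b\<in>{0, 1}. W_bracket_hom m n t (tau m i) (X m i) i b (lam_part b (w j)) j) =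
     fD (lam_mult m n t (X m i) (D m n t i (w j)) - (if j = i then w j else 0)) j" for j
  proof -
    have "W_bracket_hom m n t (tau m i) (X m i) i b (lam_part b (w j)) j =
        fD (lam_mult m n t (X m i) (D m n t i (lam_part b (w j))) - (if j = i then lam_part b (w j) else 0)) j" for b
      unfolding W_bracket_hom_def DX self
      by (auto simp: wscale_def lscale_def fun_eq_iff fD_def
          lam_mult_one_right[OF lam_part_in_Lam[OF W_Lam[OF assms(4)]]])
    moreover have "fD (g - h) j + fD (g' - h') j = fD (g + g' - (h + h')) j" for g h g' h' :: "'a lam"
      by (simp add: fD_def fun_eq_iff)
    moreover have "(if j = i then lam_part 0 (w j) else 0) + (if j = i then lam_part 1 (w j) else 0) =
        (if j = i then w j else 0)"
      by (simp add: lam_part_add)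
    moreover have "lam_mult m n t (X m i) (D m n t i (lam_part 0 (w j))) +
        lam_mult m n t (X m i) (D m n t i (lam_part 1 (w j))) = lam_mult m n t (X m i) (D m n t i (w j))"
      by (simp only: D_sum_parts flip: lam_mult_add_right)
    ultimately show ?thesis by simp
  qed
  note sum_b = this
  have "w j = 0" if "j \<notin> Y m n" for j using assms(4) that by (simp add: W_def)
  then show ?thesis
    unfolding W_bracket_fD[OF par assms(3)] sum_b sum_fD[OF finite_Y] by auto
qed

lemma W_bracket_add_left: "W_bracket m n t (v + v') w = W_bracket m n t v w + W_bracket m n t v' w"
proof -
  have D_add: "D m n t i (f + g) = D m n t i f + D m n t i g" for i and f g :: "'a lam"
    by (simp add: D_def fun_eq_iff sum_fun_apply lscale_def algebra_simps sum.distrib)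
  have "W_bracket_hom m n t a (f + f') i b g j =
      W_bracket_hom m n t a f i b g j + W_bracket_hom m n t a f' i b g j" for a b i j and f f' g :: "'a lam"
    by (auto simp: W_bracket_hom_def D_add lam_mult_add_left lam_mult_add_right fD_def wscale_def
        lscale_def fun_eq_iff algebra_simps)
  then show ?thesis unfolding W_bracket_def by (simp add: lam_part_plus sum.distrib algebra_simps)
qed

section \<open>Super skew-symmetry of the bracket\<close>

lemma W_hom_part:
  assumes "w \<in> W_hom m n t \<gamma>" "i \<in> Y m n"
  shows "lam_part d (w i) = (if d = \<gamma> + tau m i then w i else 0)"
  using assms lam_part_lam_part[of d "\<gamma> + tau m i" "w i"] unfolding W_hom_def by auto

lemma W_bracket_W_hom:
  assumes "v \<in> W_hom m n t \<alpha>" "w \<in> W_hom m n t \<beta>"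
  shows "W_bracket m n t v w =
    (\<Sum>i\<in>Y m n. \<Sum>j\<in>Y m n. W_bracket_hom m n t (\<alpha> + tau m i) (v i) i (\<beta> + tau m j) (w j) j)"
proof -
  have "(\<Sum>a\<in>{0, 1}. \<Sum>b\<in>{0, 1}. W_bracket_hom m n t a (lam_part a (v i)) i b (lam_part b (w j)) j) =
      W_bracket_hom m n t (\<alpha> + tau m i) (v i) i (\<beta> + tau m j) (w j) j"
    if "i \<in> Y m n" "j \<in> Y m n" for i j
    unfolding W_hom_part[OF assms(1) that(1)] W_hom_part[OF assms(2) that(2)]
    by (cases "\<alpha> + tau m i"; cases "\<beta> + tau m j") simp_all
  then show ?thesis unfolding W_bracket_def by (intro sum.cong refl) auto
qed

lemma W_bracket_skew:
  assumes "v \<in> W_hom m n t \<alpha>" "w \<in> W_hom m n t \<beta>"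
  shows "W_bracket m n t v w = - wscale (sgn2 (\<alpha> * \<beta>)) (W_bracket m n t w v)"
proof -
  let ?B = "\<lambda>i j. W_bracket_hom m n t (\<beta> + tau m j) (w j) j (\<alpha> + tau m i) (v i) i"
  \<comment> \<open>The coefficient of \<open>D_j\<close> in \<open>w\<close> has parity
    \<open>\<beta> + tau m j\<close>; adding \<open>tau m j\<close> again recovers the degree
    \<beta> of the whole term.\<close>
  have cancel: "a + b + b = a" for a b :: bit
    by (cases a; cases b) simp_all
  have "W_bracket_hom m n t (\<alpha> + tau m i) (v i) i (\<beta> + tau m j) (w j) j =
      - wscale (sgn2 (\<alpha> * \<beta>)) (?B i j)" for i j
    unfolding W_bracket_hom_def cancel
    by (cases "\<alpha> * \<beta> = 0") (auto simp: mult.commute[of \<beta> \<alpha>] wscale_def lscale_def fun_eq_iff sgn2_def)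
  then have "W_bracket m n t v w = (\<Sum>i\<in>Y m n. \<Sum>j\<in>Y m n. - wscale (sgn2 (\<alpha> * \<beta>)) (?B i j))"
    unfolding W_bracket_W_hom[OF assms] by (intro sum.cong refl)
  also have "\<dots> = - wscale (sgn2 (\<alpha> * \<beta>)) (\<Sum>i\<in>Y m n. \<Sum>j\<in>Y m n. ?B i j)"
    by (simp add: wscale_def lscale_def fun_eq_iff sum_fun_apply sum_distrib_left sum_negf)
  also have "(\<Sum>i\<in>Y m n. \<Sum>j\<in>Y m n. ?B i j) = W_bracket m n t w v"
    unfolding W_bracket_W_hom[OF assms(2,1)] by (rule sum.swap)
  finally show ?thesis .
qed

section \<open>The two arguments in the theorem, and toral weights\<close>

lemma Dij_hom:
  assumes "lam_part d f = f"
  shows "Dij m n t i j f = - wscale (sgn2 (d * (tau m i + tau m j))) (fD (D m n t j f) i)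
    + wscale (sgn2 (tau m i * tau m j)) (fD (D m n t i f) j)"
proof -
  have f: "lam_part a f = (if a = d then f else 0)" for a
    using lam_part_lam_part[of a d f] assms by simp
  have w0: "wscale c 0 = 0" for c :: 'a by (simp add: wscale_def lscale_def fun_eq_iff)
  show ?thesis unfolding Dij_def f by (cases d) (simp_all add: w0)
qed

definition H :: "nat \<Rightarrow> nat \<Rightarrow> nat \<Rightarrow> 'a::field wfam"
  where "H m k l = fD (X m k) k + fD (X m l) l"

text \<open>The eigenvalue of \<open>ad H\<close> on the term \<open>x^a D_j\<close>. It lies in the
  field, so exponents count only modulo the characteristic.\<close>

definition wt :: "nat \<Rightarrow> nat \<Rightarrow> nat \<Rightarrow> monom \<Rightarrow> 'a::field"
  where "wt k l j a = of_nat (fst a k) + (if l \<in> snd a then 1 else 0) - (if j = k \<or> j = l then 1 else 0)"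

interpretation wfam: vector_space wscale
  by (rule vector_space_wscale)

text \<open>\<open>F\<close> is a type token tying the locale to the coefficient field.\<close>

locale special_superalgebra =
  fixes m n :: nat and t :: "nat \<Rightarrow> nat" and F :: "'a::field itself"
  assumes m: "m \<ge> 2" and n: "n \<ge> 2" and char: "CHAR('a) > 2"
    and t: "\<And>i. i \<in> Y0 m \<Longrightarrow> t i > 0"
begin

lemma two_neq_zero: "(2 :: 'a) \<noteq> 0"
proof
  assume "(2 :: 'a) = 0"
  then have "of_nat 2 = (0 :: 'a)" by simp
  then have "CHAR('a) dvd 2" by (simp only: of_nat_eq_0_iff_char_dvd)
  then show False using char dvd_imp_le by fastforce
qed

lemma monoms_eps: "k \<in> Y0 m \<Longrightarrow> u \<subseteq> Y1 m n \<Longrightarrow> (eps k, u) \<in> monoms CHAR('a) m n t"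
  using eps_in_monoms[OF char] t by blast

lemma X_in_Lam: "i \<in> Y m n \<Longrightarrow> (X m i :: 'a lam) \<in> Lam m n t"
  using X_even[of i m, where 'a = 'a] X_odd[of i m, where 'a = 'a] monoms_eps[of i "{}"]
    odd_in_monoms[of i m n] basis_elem_in_Lam[where 'a = 'a]
  by (cases "i \<in> Y0 m") (auto simp: Y_def)

lemma D_Xi: "j \<in> Y m n \<Longrightarrow> D m n t i (X m j :: 'a lam) = (if i = j then one_lam else 0)"
  using D_X[OF char, where t = t and m = m and n = n] t by blast

lemma X_mult_even_odd:
  assumes "k \<in> Y0 m" "l \<in> Y1 m n"
  shows "lam_mult m n t (X m k) (X m l) = (basis_elem (eps k, {l}) :: 'a lam)"
    and "lam_mult m n t (X m l) (X m k) = (basis_elem (eps k, {l}) :: 'a lam)"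
proof -
  note l = Y1_notin_Y0[OF assms(2)]
  have A: "eps k \<in> A_set CHAR('a) m t" using monoms_eps[OF assms(1), of "{}"] by (simp add: monoms_def)
  show "lam_mult m n t (X m k) (X m l) = (basis_elem (eps k, {l}) :: 'a lam)"
    unfolding X_even[OF assms(1)] X_odd[OF l]
      lam_mult_basis[OF monoms_eps[OF assms(1) empty_subsetI] odd_in_monoms[OF assms(2)]]
    using A by (simp add: monom_mult_def lscale_def)
  show "lam_mult m n t (X m l) (X m k) = (basis_elem (eps k, {l}) :: 'a lam)"
    unfolding X_even[OF assms(1)] X_odd[OF l]
      lam_mult_basis[OF odd_in_monoms[OF assms(2)] monoms_eps[OF assms(1) empty_subsetI]]
    using A by (simp add: monom_mult_def lscale_def)
qed

lemma part_eps_odd: "lam_part 1 (basis_elem (eps k, {l})) = (basis_elem (eps k, {l}) :: 'a lam)"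
  by (simp add: lam_part_basis monom_parity_def)

lemma D_eps_odd:
  assumes "k \<in> Y0 m" "l \<in> Y1 m n"
  shows "D m n t i (basis_elem (eps k, {l})) =
    (if i = k then X m l else if i = l then X m k else (0 :: 'a lam))"
proof -
  have "{l} \<subseteq> Y1 m n" using assms by simp
  moreover have "l \<noteq> k" using assms Y1_notin_Y0 by blast
  ultimately show ?thesis
    unfolding D_basis[OF monoms_eps[OF assms(1) \<open>{l} \<subseteq> Y1 m n\<close>]]
    using D_monom_eps[OF assms(1), of "{l}", where 'a = 'a] X_even[OF assms(1), where 'a = 'a]
      X_odd[OF Y1_notin_Y0[OF assms(2)], where 'a = 'a]
      assms Y1_notin_Y0[OF assms(2)]
    by (auto simp: D_monom_def lscale_def card_less_self)
qed

text \<open>Both the argument and \<open>tau m k + tau m l\<close> are odd, so the leading minus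
  sign in \<open>Dij\<close> cancels and both terms are positive.\<close>

lemma Dij_H:
  assumes "k \<in> Y0 m" "l \<in> Y1 m n"
  shows "Dij m n t k l (lam_mult m n t (X m k) (X m l)) = (H m k l :: 'a wfam)"
proof -
  have "l \<noteq> k" using assms Y1_notin_Y0 by blast
  then show ?thesis
    using assms unfolding X_mult_even_odd(1)[OF assms] Dij_hom[OF part_eps_odd] D_eps_odd[OF assms]
    by (simp add: tau_simps(1)[OF assms(1)] tau_simps(2)[OF assms(2)] H_def wscale_def lscale_def fun_eq_iff)
qed

text \<open>\<open>D_i\<close> kills \<open>x_j x_k\<close>, so only
  \<open>- D_j(x_j x_k) D_i\<close> remains, from which \<open>j\<close> has disappeared.\<close>

lemma Dij_E:
  assumes "k \<in> Y0 m" "i \<in> Y1 m n" "j \<in> Y1 m n" "j \<noteq> i"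
  shows "Dij m n t i j (lam_mult m n t (X m j) (X m k)) = (- fD (X m k) i :: 'a wfam)"
proof -
  have "i \<noteq> k" using assms Y1_notin_Y0 by blast
  then show ?thesis
    using assms unfolding X_mult_even_odd(2)[OF assms(1,3)] Dij_hom[OF part_eps_odd] D_eps_odd[OF assms(1,3)]
    by (simp add: tau_simps(2)[OF assms(2)] tau_simps(2)[OF assms(3)] wscale_def lscale_def fun_eq_iff)
qed

text \<open>Both Euler operators are diagonal on monomials; differentiating \<open>x_k\<close> or
  \<open>x_l\<close> by \<open>D_j\<close> accounts for the -1 in \<open>wt\<close>.\<close>

lemma W_bracket_H:
  fixes w :: "'a wfam"
  assumes "k \<in> Y0 m" "l \<in> Y1 m n" "w \<in> W m n t"
  shows "W_bracket m n t (H m k l) w j a = wt k l j a * w j a"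
proof -
  note Y = Y0_in_Y[OF assms(1)] Y1_in_Y[OF assms(2)]
  have "l \<noteq> k" using assms Y1_notin_Y0 by blast
  have XD: "W_bracket m n t (fD (X m i) i) w =
    (\<lambda>j. lam_mult m n t (X m i) (D m n t i (w j)) - (if j = i then w j else 0))" if "i \<in> Y m n" for i
    by (rule W_bracket_XD) (use that char t assms in auto)
  have XDk: "lam_mult m n t (X m k) (D m n t k (w j)) (\<alpha>, u) = of_nat (\<alpha> k) * w j (\<alpha>, u)" for \<alpha> u
    by (rule X_D_even) (use char t assms W_Lam in auto)
  obtain \<alpha> u where a: "a = (\<alpha>, u)" by (cases a)
  show ?thesis
    unfolding H_def W_bracket_add_left XD[OF Y(1)] XD[OF Y(2)] a
    using \<open>l \<noteq> k\<close>
    by (auto simp: wt_def algebra_simps XDk X_D_odd[OF assms(2) W_Lam[OF assms(3)]])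
qed

section \<open>Homogeneous elements of S\<close>

abbreviation Sp :: "bit \<Rightarrow> 'a wfam set"
  where "Sp d \<equiv> S_hom m n t d"

lemma Sp_W_hom: "x \<in> Sp d \<Longrightarrow> x \<in> W_hom m n t d"
  and Sp_W: "x \<in> Sp d \<Longrightarrow> x \<in> W m n t"
  and Sp_S: "x \<in> Sp d \<Longrightarrow> x \<in> S m n t"
  by (auto simp: S_hom_def W_hom_def)

lemma S_Dij: "i \<in> Y m n \<Longrightarrow> j \<in> Y m n \<Longrightarrow> f \<in> Lam m n t \<Longrightarrow> (Dij m n t i j f :: 'a wfam) \<in> S m n t"
  unfolding S_def by (rule wfam.span_base) blast

lemma S_uminus: "- w \<in> S m n t \<Longrightarrow> w \<in> S m n t"
  using wfam.span_neg[of "- w"] unfolding S_def by fastforce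

lemma eps_odd_in_Lam:
  "k \<in> Y0 m \<Longrightarrow> l \<in> Y1 m n \<Longrightarrow> (basis_elem (eps k, {l}) :: 'a lam) \<in> Lam m n t"
  by (intro basis_elem_in_Lam monoms_eps) auto

lemma part_X: "lam_part (tau m i) (X m i) = (X m i :: 'a lam)"
  by (auto simp: X_def tau_def lam_part_basis monom_parity_def)

lemma H_in_Sp:
  assumes "k \<in> Y0 m" "l \<in> Y1 m n"
  shows "H m k l \<in> Sp 0"
proof -
  have "(H m k l :: 'a wfam) \<in> S m n t"
    using S_Dij[OF Y0_in_Y[OF assms(1)] Y1_in_Y[OF assms(2)] eps_odd_in_Lam[OF assms]]
    unfolding X_mult_even_odd(1)[OF assms, symmetric] Dij_H[OF assms] .
  moreover have XD: "(fD (X m i) i :: 'a wfam) \<in> W_hom m n t 0" if "i \<in> Y m n" for i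
    using that part_X[of i] X_in_Lam by (intro fD_in_W_hom) (simp_all only: add_0_left)
  have "(fD (X m k) k + fD (X m l) l :: 'a wfam) \<in> W_hom m n t 0"
    using XD[OF Y0_in_Y[OF assms(1)]] XD[OF Y1_in_Y[OF assms(2)]]
    by (rule W_hom_add)
  ultimately show ?thesis by (simp add: S_hom_def H_def)
qed

lemma E_in_Sp:
  assumes "k \<in> Y0 m" "i \<in> Y1 m n"
  shows "(fD (X m k) i :: 'a wfam) \<in> Sp 1"
proof -
  \<comment> \<open>\<open>n \<ge> 2\<close> supplies a second odd index, which writes
    \<open>x_kD_i\<close> as \<open>- D_ij(x_j x_k)\<close>.\<close>
  obtain j where j: "j \<in> Y1 m n" "j \<noteq> i"
  proof (cases "i = m + 1")
    case True
    then show ?thesis using n by (intro that[of "m + 2"]) (auto simp: Y1_def)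
  next
    case False
    then show ?thesis using n by (intro that[of "m + 1"]) (auto simp: Y1_def)
  qed
  have "(- fD (X m k) i :: 'a wfam) \<in> S m n t"
    using S_Dij[OF Y1_in_Y[OF assms(2)] Y1_in_Y[OF j(1)] eps_odd_in_Lam[OF assms(1) j(1)]]
    unfolding X_mult_even_odd(2)[OF assms(1) j(1), symmetric] Dij_E[OF assms j] .
  moreover have "(fD (X m k) i :: 'a wfam) \<in> W_hom m n t 1"
    using assms part_X[of k] X_in_Lam Y0_in_Y Y1_in_Y
    by (intro fD_in_W_hom) (simp_all add: tau_simps)
  ultimately show ?thesis using S_uminus by (simp add: S_hom_def)
qed

lemma D_in_Sp:
  assumes "i \<in> Y m n"
  shows "(fD one_lam i :: 'a wfam) \<in> Sp (tau m i)"
proof -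
  \<comment> \<open>\<open>m \<ge> 2\<close> supplies an even index other than \<open>i\<close>,
    which writes \<open>D_i\<close> as \<open>- D_ij(x_j)\<close>.\<close>
  obtain j where j: "j \<in> Y0 m" "j \<noteq> i"
  proof (cases "i = 1")
    case True
    then show ?thesis using m by (intro that[of 2]) (auto simp: Y0_def)
  next
    case False
    then show ?thesis using m by (intro that[of 1]) (auto simp: Y0_def)
  qed
  have "(Dij m n t i j (X m j) :: 'a wfam) = - fD one_lam i"
    unfolding Dij_hom[OF part_X] D_Xi[OF Y0_in_Y[OF j(1)]]
    using j by (simp add: tau_simps(1)[OF j(1)] wscale_def lscale_def fun_eq_iff)
  moreover have "(Dij m n t i j (X m j) :: 'a wfam) \<in> S m n t"
    using S_Dij assms Y0_in_Y j(1) X_in_Lam by blast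
  ultimately have "(fD one_lam i :: 'a wfam) \<in> S m n t" by (simp add: S_uminus)
  moreover have "tau m i + tau m i = 0" by (cases "tau m i") simp_all
  then have "(fD one_lam i :: 'a wfam) \<in> W_hom m n t (tau m i)"
    using assms by (intro fD_in_W_hom basis_elem_in_Lam one_in_monoms)
      (simp_all add: lam_part_basis monom_parity_def)
  ultimately show ?thesis by (simp add: S_hom_def)
qed

section \<open>Toral eigenvectors, and elements killed by derivations\<close>

lemma bracket_H_H:
  assumes "k \<in> Y0 m" "l \<in> Y1 m n" "k' \<in> Y0 m" "l' \<in> Y1 m n"
  shows "W_bracket m n t (H m k l) (H m k' l') = (0 :: 'a wfam)"
proof -
  \<comment> \<open>Each term \<open>x_jD_j\<close> of a toral element has weight zero.\<close>
  have "(wt k l j a :: 'a) * H m k' l' j a = 0" for j a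
  proof -
    have ne: "l' \<noteq> k'" "l' \<noteq> k" "l \<noteq> k'" using assms Y1_notin_Y0 by blast+
    have "H m k' l' j a = (if j = k' \<and> a = (eps k', {}) \<or> j = l' \<and> a = (0, {l'}) then 1 else (0 :: 'a))"
      unfolding H_def X_even[OF assms(3)] X_odd[OF Y1_notin_Y0[OF assms(4)]]
      using ne by (simp add: fD_def basis_elem_def)
    moreover have "(wt k l k' (eps k', {}) :: 'a) = 0" "(wt k l l' (0, {l'}) :: 'a) = 0"
      using ne by (auto simp: wt_def eps_def)
    ultimately show ?thesis by auto
  qed
  then show ?thesis
    using W_bracket_H[OF assms(1,2) Sp_W[OF H_in_Sp[OF assms(3,4)]]] by (auto simp: fun_eq_iff)
qed

lemma bracket_H_D:
  assumes "k \<in> Y0 m" "l \<in> Y1 m n" "i \<in> Y m n"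
  shows "W_bracket m n t (H m k l) (fD one_lam i) =
    (wscale (- (if i = k \<or> i = l then 1 else 0)) (fD one_lam i) :: 'a wfam)"
  using W_bracket_H[OF assms(1,2) Sp_W[OF D_in_Sp[OF assms(3)]]]
  by (auto simp: fun_eq_iff wt_def fD_def basis_elem_def wscale_def lscale_def)

lemma bracket_H_E:
  assumes "k' \<in> Y0 m" "l' \<in> Y1 m n" "k \<in> Y0 m" "i \<in> Y1 m n"
  shows "W_bracket m n t (H m k' l') (fD (X m k) i) =
    (wscale ((if k = k' then 1 else 0) - (if i = l' then 1 else 0)) (fD (X m k) i) :: 'a wfam)"
proof -
  have "i \<noteq> k'" using assms Y1_notin_Y0 by blast
  then show ?thesis
  using W_bracket_H[OF assms(1,2) Sp_W[OF E_in_Sp[OF assms(3,4)]]]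
  by (auto simp: fun_eq_iff wt_def fD_def basis_elem_def wscale_def lscale_def X_even[OF assms(3)] eps_def)
qed

text \<open>If a variable other than \<open>x_k\<close> occurred in a monomial of \<open>f\<close>,
  its derivation would lower it and keep the coefficient up to sign.\<close>

lemma Lam_constant:
  assumes "f \<in> Lam m n t" "\<And>e. e \<in> Y m n \<Longrightarrow> e \<noteq> k \<Longrightarrow> D m n t e f = 0"
    "k \<in> Y0 m" "(f :: 'a lam) (\<alpha>, u) \<noteq> 0"
  shows "u = {} \<and> (\<forall>e. e \<noteq> k \<longrightarrow> \<alpha> e = 0)"
proof (rule ccontr)
  assume neg: "\<not> ?thesis"
  have mon: "(\<alpha>, u) \<in> monoms CHAR('a) m n t" using Lam_zero[OF assms(1)] assms(4) by blast
  consider e where "e \<in> u" | e where "e \<noteq> k" "\<alpha> e \<noteq> 0" using neg by blast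
  then show False
  proof cases
    case 1
    then have e: "e \<in> Y1 m n" using mon by (auto simp: monoms_def B_set_def)
    then have "e \<noteq> k" using assms(3) Y1_notin_Y0 by blast
    then have "D m n t e f (\<alpha>, u - {e}) = 0" using assms(2) e Y1_in_Y by simp
    then show False
      using D_odd[OF assms(1) Y1_notin_Y0[OF e], of \<alpha> "u - {e}"] 1 assms(4) by (simp add: insert_absorb)
  next
    case 2
    then have e: "e \<in> Y0 m" using mon by (auto simp: monoms_def A_set_def)
    then have "D m n t e f (\<alpha>(e := \<alpha> e - 1), u) = 0" using assms(2) 2 Y0_in_Y by simp
    then show False
      using D_even[OF assms(1) e, of "\<alpha>(e := \<alpha> e - 1)" u] 2 assms(4) by simp
  qed
qed

end


section \<open>Skew-symmetric super-biderivations\<close>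

locale special_biderivation = special_superalgebra m n t F
  for m n t and F :: "'a::field itself" +
  fixes \<phi> :: "'a wfam \<Rightarrow> 'a wfam \<Rightarrow> 'a wfam" and \<gamma> :: bit
  assumes homogeneous: "homogeneous_bilinear_map wscale (S m n t) (S_hom m n t) \<gamma> \<phi>"
    and derivation: "\<And>\<alpha> \<beta> \<delta> x y z. x \<in> S_hom m n t \<alpha> \<Longrightarrow> y \<in> S_hom m n t \<beta> \<Longrightarrow> z \<in> S_hom m n t \<delta> \<Longrightarrow>
      \<phi> x (W_bracket m n t y z) = W_bracket m n t (\<phi> x y) z
        + wscale (sgn2 ((\<gamma> + \<alpha>) * \<beta>)) (W_bracket m n t y (\<phi> x z))"
    and skew: "\<And>\<alpha> \<beta> x y. x \<in> S_hom m n t \<alpha> \<Longrightarrow> y \<in> S_hom m n t \<beta> \<Longrightarrow>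
      \<phi> x y = - wscale (sgn2 (\<gamma> * \<alpha> + \<gamma> * \<beta> + \<alpha> * \<beta>)) (\<phi> y x)"
begin

abbreviation br where "br \<equiv> W_bracket m n t"

section \<open>Elementary consequences of the biderivation axioms\<close>

lemma phi_Sp: "x \<in> Sp \<alpha> \<Longrightarrow> y \<in> Sp \<beta> \<Longrightarrow> \<phi> x y \<in> Sp (\<alpha> + \<beta> + \<gamma>)"
  using homogeneous unfolding homogeneous_bilinear_map_def by blast

lemma phi_W: "x \<in> Sp \<alpha> \<Longrightarrow> y \<in> Sp \<beta> \<Longrightarrow> \<phi> x y \<in> W m n t"
  using phi_Sp Sp_W by blast

lemma phi_scale: "x \<in> Sp \<alpha> \<Longrightarrow> y \<in> Sp \<beta> \<Longrightarrow> \<phi> x (wscale c y) = wscale c (\<phi> x y)"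
  using homogeneous Sp_S unfolding homogeneous_bilinear_map_def bilinear_on_def by blast

lemma phi_zero: "x \<in> Sp \<alpha> \<Longrightarrow> \<phi> x 0 = 0"
  using phi_scale[of x \<alpha> x \<alpha> 0] wfam.scale_zero_left by simp

text \<open>For even \<open>x\<close> the skew sign is -1 whatever \<gamma> is, and 2 is
  invertible.\<close>

lemma phi_self:
  assumes "x \<in> Sp 0"
  shows "\<phi> x x = 0"
proof -
  have "\<phi> x x j a + \<phi> x x j a = 0" for j a
    using fun_cong[OF fun_cong[OF skew[OF assms assms]], of j a] by (simp add: wscale_def lscale_def)
  then have "2 * \<phi> x x j a = 0" for j a by (simp only: mult_2)
  then show ?thesis using two_neq_zero by (simp add: fun_eq_iff)
qed

lemma derivation_even:
  assumes "x \<in> Sp \<alpha>" "u \<in> Sp 0" "w \<in> Sp \<beta>"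
  shows "\<phi> x (br u w) = br (\<phi> x u) w + br u (\<phi> x w)"
  using derivation[OF assms] by simp

text \<open>
  Expand \<open>\<phi>([x,u],w) = 0\<close> for toral \<open>x\<close>, \<open>u\<close>, using the derivation property in the first argument.
\<close>

lemma toral_exchange:
  assumes kl: "k \<in> Y0 m" "l \<in> Y1 m n" and kl': "k' \<in> Y0 m" "l' \<in> Y1 m n" and w: "w \<in> Sp \<beta>"
  shows "wt k l j a * \<phi> (H m k' l') w j a = wt k' l' j a * \<phi> (H m k l) w j a"
proof -
  \<comment> \<open>The factor that swaps the arguments of \<phi> when one is \<open>w\<close> and
    the other is even; being the same for both toral elements, it cancels at the end.\<close>
  define s :: 'a where "s = - sgn2 (\<gamma> * \<beta>)"
  have s: "s \<noteq> 0" by (simp add: s_def sgn2_def)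
  note x = H_in_Sp[OF kl] and u = H_in_Sp[OF kl']
  have flip: "\<phi> w y = wscale s (\<phi> y w)" if "y \<in> Sp 0" for y
    using skew[OF w that] by (simp add: s_def wscale_def lscale_def fun_eq_iff)
  have "0 = br (\<phi> w (H m k l)) (H m k' l') + br (H m k l) (\<phi> w (H m k' l'))"
    using derivation_even[OF w x u] bracket_H_H[OF kl kl'] phi_zero[OF w] by simp
  moreover have "br (\<phi> w (H m k l)) (H m k' l') = - br (H m k' l') (\<phi> w (H m k l))"
    using W_bracket_skew[OF Sp_W_hom[OF phi_Sp[OF w x]] Sp_W_hom[OF u]] by simp
  ultimately have "br (H m k' l') (\<phi> w (H m k l)) = br (H m k l) (\<phi> w (H m k' l'))" by simp
  then have "wt k' l' j a * \<phi> w (H m k l) j a = wt k l j a * \<phi> w (H m k' l') j a"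
    using W_bracket_H[OF kl' phi_W[OF w x]] W_bracket_H[OF kl phi_W[OF w u]] by metis
  then show ?thesis using s by (simp add: flip[OF x] flip[OF u] wscale_def lscale_def)
qed

text \<open>The derivation rule applied to \<open>[H,w] = bw\<close>, read at one coefficient. The
  term with \<open>\<phi>(x,H)\<close> is kept, since this lemma serves to prove that it vanishes
  for toral \<open>x\<close>.\<close>

lemma toral_derivation:
  assumes kl: "k \<in> Y0 m" "l \<in> Y1 m n" and x: "x \<in> Sp \<alpha>" and w: "w \<in> Sp \<beta>"
    and eigen: "br (H m k l) w = wscale b w"
  shows "b * \<phi> x w j a = br (\<phi> x (H m k l)) w j a + wt k l j a * \<phi> x w j a"
proof -
  have "wscale b (\<phi> x w) = br (\<phi> x (H m k l)) w + br (H m k l) (\<phi> x w)"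
    using derivation_even[OF x H_in_Sp[OF kl] w] phi_scale[OF x w] eigen by simp
  then have "wscale b (\<phi> x w) j a = br (\<phi> x (H m k l)) w j a + br (H m k l) (\<phi> x w) j a"
    by simp
  then show ?thesis by (simp add: W_bracket_H[OF kl phi_W[OF x w]] wscale_def lscale_def)
qed

section \<open>The values of \<phi> on pairs of toral elements\<close>

lemma phi_toral_antisym:
  assumes "x \<in> Sp 0" "u \<in> Sp 0"
  shows "\<phi> x u = - \<phi> u x"
  using skew[OF assms] by simp

text \<open>Applying \<open>D_e\<close> to something of weight zero produces the weight of
  \<open>D_e\<close> itself, because each coefficient is moved from a monomial with one more factor
  \<open>x_e\<close>.\<close>

lemma wt_D_shift:
  assumes kl: "k \<in> Y0 m" "l \<in> Y1 m n" and f: "f \<in> Lam m n t" and e: "e \<in> Y m n"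
    and "\<And>a. wt k l j a * f a = (0 :: 'a)"
  shows "wt k l j a * D m n t e f a = - (if e = k \<or> e = l then 1 else 0) * D m n t e f a"
proof -
  obtain \<alpha> u where a: "a = (\<alpha>, u)" by (cases a)
  have "l \<noteq> k" using kl Y1_notin_Y0 by blast
  show ?thesis
  proof (cases "e \<in> Y0 m")
    case True
    then have "e \<noteq> l" using kl Y1_notin_Y0 by blast
    have "wt k l j (\<alpha>(e := \<alpha> e + 1), u) = wt k l j (\<alpha>, u) + (if e = k then 1 else (0 :: 'a))"
      by (auto simp: wt_def)
    then show ?thesis
      using assms(5)[of "(\<alpha>(e := \<alpha> e + 1), u)"] \<open>e \<noteq> l\<close>
      by (auto simp: a D_even[OF f True] algebra_simps add_eq_0_iff)
  next
    case False
    then have "e \<noteq> k" using kl by blast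
    have "e \<notin> u \<Longrightarrow> wt k l j (\<alpha>, insert e u) = wt k l j (\<alpha>, u) + (if e = l then 1 else (0 :: 'a))"
      by (auto simp: wt_def)
    then show ?thesis
      using assms(5)[of "(\<alpha>, insert e u)"] \<open>e \<noteq> k\<close>
      by (auto simp: a D_odd[OF f False] algebra_simps add_eq_0_iff)
  qed
qed

text \<open>Supplies a toral element under which \<open>D_j\<close> has weight -1.\<close>

lemma H_containing:
  assumes "j \<in> Y m n"
  obtains k l where "k \<in> Y0 m" "l \<in> Y1 m n" "j = k \<or> j = l"
proof -
  have "1 \<in> Y0 m" "m + 1 \<in> Y1 m n" using m n by (auto simp: Y0_def Y1_def)
  then show thesis using assms that by (cases "j \<in> Y0 m") (auto simp: Y_def)
qed

lemma W_zero:
  assumes "w \<in> W m n t" "\<And>j a. j \<in> Y m n \<Longrightarrow> w j a = 0"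
  shows "w = 0"
proof -
  have "w j a = 0" for j a using assms by (cases "j \<in> Y m n") (auto simp: W_def)
  then show ?thesis by (simp add: fun_eq_iff)
qed

text \<open>
  Put \<open>c = \<phi>(u,x)\<close>. The exchange law gives \<open>[x,c] = [u,c] = 0\<close>. For \<open>[x,w] = aw\<close> and \<open>[u,w] = bw\<close>,
  expanding \<open>\<phi>(u,[x,w])\<close> and \<open>\<phi>(x,[u,w])\<close> gives \<open>a \<phi>(u,w) - b \<phi>(x,w) = 2[c,w]\<close>, and applying
  \<open>ad x\<close> and \<open>ad u\<close> yields \<open>a[c,w] = b[c,w] = 0\<close>. In all cases \<open>[c,w] = 0\<close>.
\<close>

lemma phi_toral:
  assumes kl: "k \<in> Y0 m" "l \<in> Y1 m n" and kl': "k' \<in> Y0 m" "l' \<in> Y1 m n"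
  shows "\<phi> (H m k' l') (H m k l) = 0"
proof -
  define x :: "'a wfam" where "x = H m k l"
  define u :: "'a wfam" where "u = H m k' l'"
  define c where "c = \<phi> u x"
  have x: "x \<in> Sp 0" and u: "u \<in> Sp 0" using H_in_Sp kl kl' by (simp_all add: x_def u_def)
  have cSp: "c \<in> Sp \<gamma>" using phi_Sp[OF u x] by (simp only: c_def add_0_left)
  note cW = Sp_W[OF cSp]
  have xu: "\<phi> x u = - c" unfolding c_def using phi_toral_antisym[OF x u] .
  have xc: "wt k l j a * c j a = 0" for j a
    using toral_exchange[OF kl kl' x, of j a] phi_self[OF x] by (simp add: c_def x_def u_def)
  have uc: "wt k' l' j a * c j a = 0" for j a
    using toral_exchange[OF kl kl' u, of j a] phi_self[OF u] xu by (simp add: x_def u_def)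
  \<comment> \<open>\<open>wx\<close> and \<open>wu\<close> say that \<open>[c,w]\<close> has the
    weights of \<open>w\<close> under \<open>x\<close> and \<open>u\<close>, at the coefficient of
    monomial \<open>i\<close> in component \<open>j\<close>.\<close>
  have main: "a * br c w j i = 0 \<and> b * br c w j i = 0 \<and> (a = 0 \<longrightarrow> b = 0 \<longrightarrow> br c w j i = 0)"
    if w: "w \<in> Sp \<beta>" and ex: "br x w = wscale a w" and eu: "br u w = wscale b w"
      and wx: "wt k l j i * br c w j i = a * br c w j i"
      and wu: "wt k' l' j i * br c w j i = b * br c w j i" for w \<beta> a b j i
  proof -
    have neg: "br (- c) w = - br c w"
    proof -
      have "br (- c) w + br c w = 0" by (simp flip: W_bracket_add_left)
      then show ?thesis by (simp add: eq_neg_iff_add_eq_0)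
    qed
    define P R A B q where "P = \<phi> u w j i" "R = \<phi> x w j i" "A = (wt k l j i :: 'a)"
      "B = (wt k' l' j i :: 'a)" "q = br c w j i"
    note d = this
    have 1: "a * P = q + A * P"
      using toral_derivation[OF kl u w, of a j i] ex by (simp add: d c_def x_def)
    have 2: "b * R = - q + B * R"
      using toral_derivation[OF kl' x w, of b j i] eu xu neg by (simp add: d u_def)
    have 3: "a * R = A * R"
      using toral_derivation[OF kl x w, of a j i] ex phi_self[OF x] by (simp add: d x_def)
    have 4: "b * P = B * P"
      using toral_derivation[OF kl' u w, of b j i] eu phi_self[OF u] by (simp add: d u_def)
    have 5: "A * P = B * R"
      using toral_exchange[OF kl kl' w, of j i] by (simp add: d x_def u_def)
    have 6: "A * q = a * q" "B * q = b * q" using wx wu by (simp_all add: d)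
    \<comment> \<open>Multiplied by \<open>A\<close>, equation 1 reads
      \<open>(a - A) A P = A q = a q\<close>; by 5 the left side is \<open>(a - A) B R\<close>,
      which is zero by 3. The case of \<open>b\<close> is symmetric.\<close>
    have "a * q = 0" using 1 3 5 6 by algebra
    moreover have "b * q = 0" using 2 4 5 6 by algebra
    \<comment> \<open>For zero weights, 1 and 2 give \<open>A P = - q\<close> and
      \<open>B R = q\<close>, so 5 forces \<open>q = - q\<close>.\<close>
    moreover have "q = 0" if "a = 0" "b = 0"
    proof -
      have "2 * q = 0" using 1 2 5 that by algebra
      then show ?thesis using two_neq_zero by simp
    qed
    ultimately show ?thesis by (simp add: d)
  qed
  \<comment> \<open>\<open>main\<close> with toral \<open>w\<close> and both weights zero:
    \<open>c\<close> commutes with every toral element.\<close>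
  have torus: "wt k'' l'' j i * c j i = 0" if kl'': "k'' \<in> Y0 m" "l'' \<in> Y1 m n" for k'' l'' j i
  proof -
    note h = H_in_Sp[OF kl'']
    have brc: "br c (H m k'' l'') j i = - (wt k'' l'' j i * c j i)" for j i
      using W_bracket_skew[OF Sp_W_hom[OF cSp] Sp_W_hom[OF h]] by (simp add: W_bracket_H[OF kl'' cW])
    have "br c (H m k'' l'') j i = 0"
      using main[OF h, of 0 0 j i] bracket_H_H[OF kl kl''] bracket_H_H[OF kl' kl''] xc[of j i] uc[of j i]
      by (auto simp: brc x_def u_def)
    then show ?thesis by (simp add: brc)
  qed
  have Dc: "D m n t e (c j) = 0" if e: "e \<in> Y m n" for e j
  proof
    fix i
    define s :: 'a where "s = - sgn2 (\<gamma> * tau m e)"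
    have s: "s \<noteq> 0" by (simp add: s_def sgn2_def)
    note De = D_in_Sp[OF e]
    have brc: "br c (fD one_lam e) j i = s * D m n t e (c j) i" for i
      using W_bracket_skew[OF Sp_W_hom[OF cSp] Sp_W_hom[OF De]]
      by (simp add: W_bracket_D[OF e cW] s_def wscale_def lscale_def)
    define a b :: 'a where "a = - (if e = k \<or> e = l then 1 else 0)" "b = - (if e = k' \<or> e = l' then 1 else 0)"
    note ab = this
    have "wt k l j i * D m n t e (c j) i = a * D m n t e (c j) i"
      unfolding ab by (rule wt_D_shift[OF kl W_Lam[OF cW] e xc])
    then have wx: "wt k l j i * br c (fD one_lam e) j i = a * br c (fD one_lam e) j i"
      by (simp only: brc mult.left_commute[of _ s])
    have "wt k' l' j i * D m n t e (c j) i = b * D m n t e (c j) i"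
      unfolding ab by (rule wt_D_shift[OF kl' W_Lam[OF cW] e uc])
    then have wu: "wt k' l' j i * br c (fD one_lam e) j i = b * br c (fD one_lam e) j i"
      by (simp only: brc mult.left_commute[of _ s])
    have "br x (fD one_lam e) = wscale a (fD one_lam e)" "br u (fD one_lam e) = wscale b (fD one_lam e)"
      unfolding ab x_def u_def using bracket_H_D kl kl' e by blast+
    \<comment> \<open>Each of \<open>a\<close> and \<open>b\<close> is 0 or -1, so one of the three
      conclusions of \<open>main\<close> gives the vanishing.\<close>
    from main[OF De this wx wu]
    have "br c (fD one_lam e) j i = 0" by auto
    then show "D m n t e (c j) i = 0 i" using s by (simp add: brc)
  qed
  have "c j i = 0" if j: "j \<in> Y m n" for j i
  proof (rule ccontr)
    assume nz: "c j i \<noteq> 0"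
    obtain \<alpha> v where i: "i = (\<alpha>, v)" by (cases i)
    \<comment> \<open>Exempting first \<open>x_1\<close> and then \<open>x_2\<close> leaves only
      constant coefficients.\<close>
    have "1 \<in> Y0 m" "2 \<in> Y0 m" using m by (auto simp: Y0_def)
    then have c1: "v = {} \<and> (\<forall>e. e \<noteq> 1 \<longrightarrow> \<alpha> e = 0)" and c2: "v = {} \<and> (\<forall>e. e \<noteq> 2 \<longrightarrow> \<alpha> e = 0)"
      using Lam_constant[OF W_Lam[OF cW] Dc, of _ j \<alpha> v] nz i by blast+
    have "\<alpha> e = 0" for e using c1 c2 by (cases "e = 1") auto
    moreover have "v = {}" using c1 by blast
    \<comment> \<open>A constant multiple of \<open>D_j\<close> has weight -1 under a toral element
      involving \<open>j\<close>, contrary to \<open>torus\<close>.\<close>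
    moreover obtain k'' l'' where "k'' \<in> Y0 m" "l'' \<in> Y1 m n" "j = k'' \<or> j = l''"
      using H_containing[OF j] .
    ultimately show False using torus[of k'' l'' j i] nz by (simp add: i wt_def)
  qed
  then have "c = 0" using W_zero[OF cW] by blast
  then show ?thesis by (simp add: c_def x_def u_def)
qed

section \<open>The maps \<open>\<phi>(H,-)\<close> on weight vectors\<close>

text \<open>By \<open>phi_toral\<close>, the bracket term in \<open>toral_derivation\<close>
  disappears.\<close>

lemma phi_weight:
  assumes kl: "k \<in> Y0 m" "l \<in> Y1 m n" and kl': "k' \<in> Y0 m" "l' \<in> Y1 m n" and w: "w \<in> Sp \<beta>"
    and "br (H m k' l') w = wscale b w"
  shows "wt k' l' j a * \<phi> (H m k l) w j a = b * \<phi> (H m k l) w j a"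
  using toral_derivation[OF kl' H_in_Sp[OF kl] w, of b j a] assms(6) phi_toral[OF kl' kl] by auto

text \<open>\<open>phi_weight\<close> replaces the coefficientwise weights in
  \<open>toral_exchange\<close> by the eigenvalues of \<open>w\<close>.\<close>

lemma phi_proportional:
  assumes kl: "k \<in> Y0 m" "l \<in> Y1 m n" and kl': "k' \<in> Y0 m" "l' \<in> Y1 m n" and w: "w \<in> Sp \<beta>"
    and "br (H m k l) w = wscale a w" "br (H m k' l') w = wscale b w"
  shows "wscale a (\<phi> (H m k' l') w) = wscale b (\<phi> (H m k l) w)"
  using phi_weight[OF kl' kl w assms(6)] phi_weight[OF kl kl' w assms(7)] toral_exchange[OF kl kl' w]
  by (simp add: wscale_def lscale_def fun_eq_iff)

text \<open>\<open>D_e\<close> has weight 0 under \<open>H m k l\<close> but -1 under some other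
  toral element, so proportionality forces the value to vanish.\<close>

lemma phi_H_D:
  assumes kl: "k \<in> Y0 m" "l \<in> Y1 m n" and e: "e \<in> Y m n" "e \<noteq> k" "e \<noteq> l"
  shows "\<phi> (H m k l) (fD one_lam e) = 0"
proof -
  obtain k' l' where kl': "k' \<in> Y0 m" "l' \<in> Y1 m n" "e = k' \<or> e = l'" using H_containing[OF e(1)] .
  have "wscale 0 (\<phi> (H m k' l') (fD one_lam e)) = wscale (- 1) (\<phi> (H m k l) (fD one_lam e))"
    using bracket_H_D[OF kl e(1)] bracket_H_D[OF kl'(1,2) e(1)] kl'(3) e
    by (intro phi_proportional[OF kl kl'(1,2) D_in_Sp[OF e(1)]]) auto
  then show ?thesis by simp
qed

text \<open>As \<open>\<phi>(H,D_e) = 0\<close>, the derivation rule on \<open>[D_e,w]\<close> says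
  that \<open>\<phi>(H,-)\<close> commutes with \<open>D_e\<close> up to a sign, which is its own
  inverse.\<close>

lemma D_phi:
  assumes kl: "k \<in> Y0 m" "l \<in> Y1 m n" and e: "e \<in> Y m n" "e \<noteq> k" "e \<noteq> l" and w: "w \<in> Sp \<beta>"
  shows "D m n t e (\<phi> (H m k l) w j) = lscale (sgn2 (\<gamma> * tau m e)) (\<phi> (H m k l) (\<lambda>j. D m n t e (w j)) j)"
proof -
  let ?x = "H m k l :: 'a wfam" and ?s = "sgn2 (\<gamma> * tau m e) :: 'a"
  note x = H_in_Sp[OF kl]
  have "\<phi> ?x (br (fD one_lam e) w) = wscale ?s (br (fD one_lam e) (\<phi> ?x w))"
    using derivation[OF x D_in_Sp[OF e(1)] w] phi_H_D[OF kl e] by simp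
  then have "\<phi> ?x (\<lambda>j. D m n t e (w j)) = wscale ?s (\<lambda>j. D m n t e (\<phi> ?x w j))"
    using W_bracket_D[OF e(1) Sp_W[OF w]] W_bracket_D[OF e(1) phi_W[OF x w]] by simp
  then show ?thesis by (simp add: wscale_def lscale_def fun_eq_iff flip: mult.assoc)
qed

lemma phi_H_E:
  assumes k: "k \<in> Y0 m" and l: "l \<in> Y1 m n" and i: "i \<in> Y1 m n" and "i \<noteq> l"
  shows "\<phi> (H m k l) (fD (X m k) i) =
    wscale (\<phi> (H m k l) (fD (X m k) i) i (eps k, {})) (fD (X m k) i)"
proof -
  define E :: "'a wfam" where "E = fD (X m k) i"
  define z where "z = \<phi> (H m k l) E"
  have E: "E \<in> Sp 1" unfolding E_def using E_in_Sp[OF k i] .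
  have zW: "z \<in> W m n t" unfolding z_def using phi_W[OF H_in_Sp[OF k l] E] .
  obtain k' where k': "k' \<in> Y0 m" "k' \<noteq> k"
  proof (cases "k = 1")
    case True
    then show ?thesis using m by (intro that[of 2]) (auto simp: Y0_def)
  next
    case False
    then show ?thesis using m by (intro that[of 1]) (auto simp: Y0_def)
  qed
  have ik: "i \<noteq> k" "i \<noteq> k'" using i k k' Y1_notin_Y0 by blast+
  \<comment> \<open>\<open>E\<close> has weight 1 under \<open>H m k l\<close> and -1 under
    \<open>H m k' i\<close>.\<close>
  have z': "\<phi> (H m k' i) E = wscale (- 1) z"
    using phi_proportional[OF k l k'(1) i E, of 1 "- 1"] bracket_H_E[OF k l k i] bracket_H_E[OF k'(1) i k i]
      \<open>i \<noteq> l\<close> k'(2) by (simp add: E_def z_def)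
  have DE: "(\<lambda>j. D m n t e (E j)) = (if e = k then fD one_lam i else 0)" for e
    using D_Xi[OF Y0_in_Y[OF k], of e] by (auto simp: E_def fD_def fun_eq_iff)
  have D_neg: "D m n t e (lscale (- 1) f) = lscale (- 1) (D m n t e f)" for e and f :: "'a lam"
    by (simp add: D_def lscale_def fun_eq_iff sum_fun_apply sum_negf)
  have Dz: "D m n t e (z j) = 0" if e: "e \<in> Y m n" "e \<noteq> k" for e j
  \<comment> \<open>\<open>H m k l\<close> commutes with \<open>D_e\<close> for \<open>e\<close>
    equal to \<open>k'\<close> or \<open>i\<close>; \<open>H m k' i\<close> does so for the
    remaining \<open>e\<close>. In both cases \<open>[D_e,E] = 0\<close>.\<close>
  proof (cases "e = k' \<or> e = i")
    case True
    then have "e \<noteq> l" using k' l \<open>i \<noteq> l\<close> Y1_notin_Y0 by blast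
    then show ?thesis
      using D_phi[OF k l e _ E, of j] DE[of e] e phi_zero[OF H_in_Sp[OF k l]]
      by (simp add: z_def lscale_def fun_eq_iff)
  next
    case False
    then have "D m n t e (wscale (- 1) z j) = 0"
      using D_phi[OF k'(1) i e(1) _ _ E, of j] DE[of e] e phi_zero[OF H_in_Sp[OF k'(1) i]]
      by (simp add: z' lscale_def fun_eq_iff)
    then show ?thesis by (simp add: wscale_def D_neg) (simp add: lscale_def fun_eq_iff)
  qed
  \<comment> \<open>\<open>H m k' i\<close> also commutes with \<open>D_k\<close>, while
    \<open>[D_k,E] = D_i\<close> and \<open>[D_k,D_i] = 0\<close>.\<close>
  have DDz: "D m n t k (D m n t k (z j)) = 0" for j
  proof -
    let ?s = "sgn2 (\<gamma> * tau m k) :: 'a"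
    have "D m n t k (wscale (- 1) z j) = lscale ?s (\<phi> (H m k' i) (fD one_lam i) j)"
      using D_phi[OF k'(1) i Y0_in_Y[OF k] _ _ E, of j] DE[of k] ik k' by (simp add: z')
    moreover have "?s = 1" by (simp add: tau_simps(1)[OF k])
    moreover have "D m n t k (\<phi> (H m k' i) (fD one_lam i) j) = 0"
    proof -
      have "(\<lambda>j. D m n t k (fD one_lam i j)) = (0 :: 'a wfam)"
        by (simp add: fD_def fun_eq_iff D_basis[OF one_in_monoms] D_monom_one)
      then show ?thesis
        using D_phi[OF k'(1) i Y0_in_Y[OF k] _ _ D_in_Sp[OF Y1_in_Y[OF i]], of j] ik k'
          phi_zero[OF H_in_Sp[OF k'(1) i]] by (simp only:) (simp add: lscale_def fun_eq_iff)
    qed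
    ultimately have "D m n t k (D m n t k (wscale (- 1) z j)) = 0" by (simp add: lscale_def)
    then show ?thesis by (simp add: wscale_def D_neg) (simp add: lscale_def fun_eq_iff)
  qed
  have weight: "wt k'' l'' j a * z j a = ((if k = k'' then 1 else 0) - (if i = l'' then 1 else 0)) * z j a"
    if "k'' \<in> Y0 m" "l'' \<in> Y1 m n" for k'' l'' j a
    unfolding z_def E_def by (rule phi_weight[OF k l that E_in_Sp[OF k i] bracket_H_E[OF that k i]])
  have "z j a = 0" if j: "j \<in> Y m n" and ne: "\<not> (j = i \<and> a = (eps k, {}))" for j a
  proof (rule ccontr)
    assume nz: "z j a \<noteq> 0"
    obtain \<alpha> u where a: "a = (\<alpha>, u)" by (cases a)
    have supp: "u = {}" "\<And>e. e \<noteq> k \<Longrightarrow> \<alpha> e = 0"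
      using Lam_constant[OF W_Lam[OF zW] Dz k, of j \<alpha> u] nz by (auto simp: a)
    \<comment> \<open>Weights determine \<open>\<alpha> k\<close> only modulo the characteristic;
      the second derivative bounds the exponent itself.\<close>
    have "\<alpha> k < 2"
    proof (rule ccontr)
      assume "\<not> \<alpha> k < 2"
      then have "(\<alpha>(k := \<alpha> k - 2))(k := \<alpha> k - 2 + 2) = \<alpha>"
        by (auto simp: fun_upd_idem_iff)
      then have "D m n t k (D m n t k (z j)) (\<alpha>(k := \<alpha> k - 2), u) = z j (\<alpha>, u)"
        using \<open>\<not> \<alpha> k < 2\<close>
        by (simp add: D_even[OF D_in_Lam[OF W_Lam[OF zW] Y0_in_Y[OF k]] k] D_even[OF W_Lam[OF zW] k])
      then show False using DDz[of j] nz by (simp add: a)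
    qed
    have wt: "wt k'' l'' j a = (if k = k'' then 1 else 0) - (if i = l'' then 1 else (0 :: 'a))"
      if "k'' \<in> Y0 m" "l'' \<in> Y1 m n" for k'' l''
      using weight[OF that, of j a] nz by simp
    \<comment> \<open>A constant coefficient has weight 0 or -1 under \<open>H m k l\<close>, but
      \<open>z\<close> has weight 1, and 1 differs from -1.\<close>
    have "\<alpha> k \<noteq> 0"
    proof
      assume "\<alpha> k = 0"
      then show False using wt[OF k l] \<open>i \<noteq> l\<close> supp(1) two_neq_zero
        by (auto simp: wt_def a split: if_splits)
    qed
    then have \<alpha>: "\<alpha> k = 1" using \<open>\<alpha> k < 2\<close> by simp
    then have "\<alpha> = eps k" using supp(2) by (auto simp: eps_def fun_eq_iff)
    then have "j \<noteq> i" using ne by (simp add: a supp(1))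
    show False
    \<comment> \<open>Test with a toral element containing \<open>j\<close>: \<open>H m j l\<close>
      for even \<open>j\<close>, \<open>H m k j\<close> for odd \<open>j\<close>. Its weight on
      \<open>x_kD_j\<close> is one less than on \<open>E\<close>.\<close>
    proof (cases "j \<in> Y0 m")
      case True
      then have "j \<noteq> l" using l Y1_notin_Y0 by blast
      then show False using wt[OF True l] \<open>i \<noteq> l\<close> supp \<alpha> by (auto simp: wt_def a split: if_splits)
    next
      case False
      then have "j \<in> Y1 m n" using j by (simp add: Y_def)
      then show False using wt[OF k, of j] \<open>j \<noteq> i\<close> supp \<alpha> by (auto simp: wt_def a split: if_splits)
    qed
  qed
  note zero = this
  have Eja: "E j a = (if j = i \<and> a = (eps k, {}) then 1 else 0)" for j a
    by (simp add: E_def fD_def X_even[OF k] basis_elem_def)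
  have "z j a = z i (eps k, {}) * E j a" for j a
  proof (cases "j \<in> Y m n \<and> \<not> (j = i \<and> a = (eps k, {}))")
    case True
    then have "z j a = 0" by (intro zero) auto
    then show ?thesis using True by (auto simp: Eja)
  next
    case False
    then consider "j = i" "a = (eps k, {})" | "j \<notin> Y m n" by blast
    then show ?thesis
    proof cases
      case 2
      then have "z j a = 0" "j \<noteq> i" using zW Y1_in_Y[OF i] by (auto simp: W_def)
      then show ?thesis by (simp add: Eja)
    qed (simp add: Eja)
  qed
  then have "z = wscale (z i (eps k, {})) E" unfolding wscale_def lscale_def by blast
  then show ?thesis unfolding z_def E_def .
qed

end

theorem lemma4p10:
  fixes m n :: nat and t :: "nat \<Rightarrow> nat"
    and \<phi> :: "'a::field wfam \<Rightarrow> 'a wfam \<Rightarrow> 'a wfam"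
  assumes "m \<ge> 2" and "n \<ge> 2"
    and "CHAR('a) > 2"
    and "\<And>i. i \<in> Y0 m \<Longrightarrow> t i > 0"
    and "skew_super_biderivation wscale (S m n t) (S_hom m n t) (W_bracket m n t) \<phi>"
  shows "\<exists>\<mu> :: nat \<Rightarrow> nat \<Rightarrow> nat \<Rightarrow> 'a.
    \<forall>k0\<in>Y0 m. \<forall>k1\<in>Y1 m n. \<forall>i1\<in>Y1 m n. \<forall>j1\<in>Y1 m n. i1 \<noteq> k1 \<longrightarrow> j1 \<noteq> i1 \<longrightarrow>
      \<phi> (Dij m n t k0 k1 (lam_mult m n t (X m k0) (X m k1)))
        (Dij m n t i1 j1 (lam_mult m n t (X m j1) (X m k0))) =
      wscale (\<mu> k0 k1 i1)
        (W_bracket m n t (Dij m n t k0 k1 (lam_mult m n t (X m k0) (X m k1)))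
                         (Dij m n t i1 j1 (lam_mult m n t (X m j1) (X m k0))))"
proof -
  obtain \<gamma> where \<gamma>: "special_biderivation m n t \<phi> \<gamma>"
    using assms unfolding skew_super_biderivation_def special_biderivation_def
      special_superalgebra_def special_biderivation_axioms_def by metis
  interpret special_biderivation m n t "TYPE('a)" \<phi> \<gamma> by (rule \<gamma>)
  show ?thesis
  \<comment> \<open>The witness is the coefficient of \<open>x_kD_i\<close> in
    \<open>\<phi>(H,E)\<close>, which does not involve \<open>j\<close>. It is already the required
    factor because \<open>[H,-E] = -E\<close>.\<close>
  proof (intro exI[of _ "\<lambda>k l i. \<phi> (H m k l) (fD (X m k) i) i (eps k, {})"] ballI impI)
    fix k l i j
    assume k: "k \<in> Y0 m" and l: "l \<in> Y1 m n" and i: "i \<in> Y1 m n" and j: "j \<in> Y1 m n"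
      and il: "i \<noteq> l" and ji: "j \<noteq> i"
    let ?E = "fD (X m k) i :: 'a wfam" and ?H = "H m k l :: 'a wfam"
    let ?c = "\<phi> ?H ?E i (eps k, {})"
    have neg: "- w = wscale (- 1) w" for w :: "'a wfam" by simp
    have "\<phi> ?H (- ?E) = wscale ?c (- ?E)"
      unfolding neg phi_scale[OF H_in_Sp[OF k l] E_in_Sp[OF k i]]
      using phi_H_E[OF k l i il] by (metis wfam.scale_left_commute)
    moreover have "br ?H (- ?E) = - ?E"
    proof -
      have "- ?E \<in> W m n t" using Sp_W[OF E_in_Sp[OF k i]] by (simp add: W_def Lam_def)
      then have "br ?H (- ?E) j a = - br ?H ?E j a" for j a
        by (simp add: W_bracket_H[OF k l] Sp_W[OF E_in_Sp[OF k i]])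
      then show ?thesis using bracket_H_E[OF k l k i] il by (simp add: fun_eq_iff)
    qed
    ultimately show "\<phi> (Dij m n t k l (lam_mult m n t (X m k) (X m l)))
        (Dij m n t i j (lam_mult m n t (X m j) (X m k))) =
      wscale ?c (W_bracket m n t (Dij m n t k l (lam_mult m n t (X m k) (X m l)))
                         (Dij m n t i j (lam_mult m n t (X m j) (X m k))))"
      unfolding Dij_H[OF k l] Dij_E[OF k i j ji] by simp
  qed
qed

end
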